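(* Let $\Phi$ be the root system of a complex reductive Lie group with maximal torus $T$ and Weyl group $W$, let $u,v\in W$, and let $$S(u,v)=\{\alpha\in\Phi^+ : u\leqslant vr_\alpha<v\}.$$ Then $$\Big(\prod_{\beta\in S(u,v)}(1-\boldsymbol{y}^\beta)\Big)\,r_{u,v}(\boldsymbol{y})$$ is analytic on $T$ (i.e. has no poles: it lies in $\mathbb{Z}[q,q^{-1}]\otimes\mathcal{O}(T)$).
   Context: $\mathcal{O}(T)$ is the ring of regular functions on the complex torus $T$, spanned by the characters $\boldsymbol{y}\mapsto\boldsymbol{y}^\lambda$, $\lambda\in\Lambda=X^*(T)\supseteq\Phi$; $q$ is an indeterminate. $W$ acts on $\Lambda$; $r_\alpha\in W$ is the reflection in the root $\alpha$; $\alpha_i$ are the simple roots and $s_i=r_{\alpha_i}$; $\Phi^+$ is the set of positive roots; $\leqslant$ is the Bruhat order. The functions $r_{u,v}(\boldsymbol{y})$, $u,v\in W$ (deformed Kazhdan–Lusztig $R$-polynomials of Bump and Nakasuji), lie in the ring obtained from $\mathbb{Z}[q,q^{-1}]\otimes\mathcal{O}(T)$ by inverting all $1-\boldsymbol{y}^\alpha$, $\alpha\in\Phi^+$, and are the unique functions (known to exist) such that: $r_{u,v}=0$ unless $u\leqslant v$; $r_{v,v}=1$; and for every simple reflection $s=s_i$ with $s_iv<v$, writing $\beta=-v^{-1}(\alpha_i)$ (a positive root), $$r_{u,v}(\boldsymbol{y})=\begin{cases}\dfrac{1-q}{1-\boldsymbol{y}^\beta}\,r_{u,sv}(\boldsymbol{y})+r_{su,sv}(\boldsymbol{y})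 & \text{if } su<u,\\[2mm] (1-q)\dfrac{\boldsymbol{y}^\beta}{1-\boldsymbol{y}^\beta}\,r_{u,sv}(\boldsymbol{y})+q\,r_{su,sv}(\boldsymbol{y}) & \text{if } su>u.\end{cases}$$ *)

theory Defs
  imports
    Complex_Main
    "HOL-Library.Poly_Mapping"
    "HOL-Library.Product_Plus"
    "HOL-Computational_Algebra.Polynomial_Factorial"
begin

section \<open>Lattices\<close>

definition (in ab_group_add) zscale :: "int \<Rightarrow> 'a \<Rightarrow> 'a" where
  "zscale k x = (\<Sum>i<nat k. x) - (\<Sum>i<nat (- k). x)"

lemma zscale_diff: "zscale (int m - int n) x = (\<Sum>i<m. x) - (\<Sum>i<n. x)"
proof -
  have split: "(\<Sum>i<a + b. x) = (\<Sum>i<a. x) + (\<Sum>i<b. x)" for a b :: nat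
    by (induction b) (auto simp: algebra_simps)
  show ?thesis
  proof (cases "n \<le> m")
    case True
    then obtain d where "m = n + d" using le_Suc_ex by blast
    then show ?thesis by (simp add: zscale_def split)
  next
    case False
    then obtain d where "n = m + d" using le_Suc_ex nat_le_linear by blast
    then show ?thesis by (simp add: zscale_def split)
  qed
qed

lemma zscale_add_left: "zscale (a + b) x = zscale a x + zscale b x"
proof -
  obtain m n where a: "a = int m - int n" by (rule int_diff_cases)
  obtain m' n' where b: "b = int m' - int n'" by (rule int_diff_cases)
  have split: "(\<Sum>i<c + d. x) = (\<Sum>i<c. x) + (\<Sum>i<d. x)" for c d :: nat
    by (induction d) (auto simp: algebra_simps)
  have "a + b = int (m + m') - int (n + n')" using a b by simp
  then show ?thesis by (simp only: a b zscale_diff split) (simp add: algebra_simps)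
qed

lemma zscale_one: "zscale 1 x = x"
  by (simp add: zscale_def)

lemma zscale_minus_left: "zscale (- a) x = - zscale a x"
  by (simp add: zscale_def)

lemma zscale_mult: "zscale a (zscale b x) = zscale (a * b) x"
proof (induction a rule: int_induct[where k = 0])
  case base
  show ?case by (simp add: zscale_def)
next
  case (step1 i)
  then show ?case
    by (simp add: zscale_add_left zscale_one distrib_right)
next
  case (step2 i)
  have "zscale (i - 1) y = zscale i y - y" for y :: 'a
    using zscale_add_left[of "i - 1" 1 y] by (simp add: zscale_one)
  moreover have "zscale ((i - 1) * b) x = zscale (i * b) x - zscale b x"
    using zscale_add_left[of "(i - 1) * b" b x] by (simp add: algebra_simps)
  ultimately show ?case using step2 by simp
qed

global_interpretation zmod: module zscale
  by unfold_locales
    (simp_all add: zscale_add_left zscale_one zscale_mult,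
     simp add: zscale_def sum.distrib)

text \<open>Free abelian groups of finite rank (rank 0 included).\<close>

class lattice_group = ab_group_add +
  assumes ex_finite_basis:
    "\<exists>B. finite B \<and> (\<forall>x. \<exists>!c. (\<forall>b. b \<notin> B \<longrightarrow> c b = 0) \<and> x = (\<Sum>b\<in>B. zscale (c b) b))"

section \<open>The coefficient rings\<close>

text \<open>
  The torus \<open>T\<close> has character lattice \<open>'l\<close>, so \<open>\<O>(T)\<close> is the group algebra of \<open>'l\<close> over
  the complex numbers. Hence \<open>\<int>[q, q\<^sup>-\<^sup>1] \<otimes> \<O>(T)\<close> (tensor product over \<open>\<int>\<close>) is the complex
  group algebra of \<open>\<int> \<times> 'l\<close>, where \<open>(k, \<mu>)\<close> is the exponent of \<open>q\<^sup>k y\<^sup>\<mu>\<close>. A new type is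
  introduced because the library makes finitely supported functions an integral domain
  only when the exponents carry a compatible linear order.
\<close>

typedef (overloaded) 'l torus_ring =
  "UNIV :: ((int \<times> 'l::lattice_group) \<Rightarrow>\<^sub>0 complex) set"
  by simp

setup_lifting type_definition_torus_ring

instantiation torus_ring :: (lattice_group) comm_ring_1
begin
lift_definition zero_torus_ring :: "'a torus_ring" is 0 .
lift_definition one_torus_ring :: "'a torus_ring" is 1 .
lift_definition plus_torus_ring :: "'a torus_ring \<Rightarrow> 'a torus_ring \<Rightarrow> 'a torus_ring" is "(+)" .
lift_definition minus_torus_ring :: "'a torus_ring \<Rightarrow> 'a torus_ring \<Rightarrow> 'a torus_ring" is "(-)" .
lift_definition uminus_torus_ring :: "'a torus_ring \<Rightarrow> 'a torus_ring" is "uminus" .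
lift_definition times_torus_ring :: "'a torus_ring \<Rightarrow> 'a torus_ring \<Rightarrow> 'a torus_ring" is "(*)" .
instance by standard (transfer, simp add: algebra_simps)+
end

lift_definition qvar :: "'l::lattice_group torus_ring" is "Poly_Mapping.single (1, 0) 1" .

lift_definition ychar :: "'l::lattice_group \<Rightarrow> 'l torus_ring"
  is "\<lambda>\<mu>. Poly_Mapping.single (0, \<mu>) 1" .

lemma ex_ordered_embedding:
  "\<exists>\<phi> :: int \<times> 'l::lattice_group \<Rightarrow> (nat \<Rightarrow>\<^sub>0 int). inj \<phi> \<and> (\<forall>x y. \<phi> (x + y) = \<phi> x + \<phi> y)"
proof -
  obtain B :: "'l set" where B: "finite B" and
    ex1: "\<forall>x. \<exists>!c. (\<forall>b. b \<notin> B \<longrightarrow> c b = 0) \<and> x = (\<Sum>b\<in>B. zscale (c b) b)"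
    using ex_finite_basis by blast
  obtain rep :: "'l \<Rightarrow> 'l \<Rightarrow> int" where
    rep0: "\<And>x b. b \<notin> B \<Longrightarrow> rep x b = 0" and
    rep: "\<And>x. (\<Sum>b\<in>B. zscale (rep x b) b) = x"
    using ex1 by metis
  have rep_add: "rep (x + y) = (\<lambda>b. rep x b + rep y b)" for x y
  proof -
    have "x + y = (\<Sum>b\<in>B. zscale (rep x b + rep y b) b)"
      by (simp add: zscale_add_left sum.distrib rep)
    moreover have "\<forall>b. b \<notin> B \<longrightarrow> rep x b + rep y b = 0"
      by (simp add: rep0)
    ultimately show ?thesis
      using ex1[rule_format, of "x + y"] rep[of "x + y"] rep0[of _ "x + y"] by metis
  qed
  obtain e :: "'l \<Rightarrow> nat" where e: "inj_on e B"
    using finite_imp_inj_to_nat_seg[OF B] by blast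
  define \<phi> :: "int \<times> 'l \<Rightarrow> (nat \<Rightarrow>\<^sub>0 int)" where
    "\<phi> = (\<lambda>(k, x). Poly_Mapping.single 0 k + (\<Sum>b\<in>B. Poly_Mapping.single (Suc (e b)) (rep x b)))"
  have add: "\<phi> (x + y) = \<phi> x + \<phi> y" for x y
    by (cases x; cases y)
      (simp add: \<phi>_def rep_add single_add sum.distrib algebra_simps)
  have look0: "Poly_Mapping.lookup (\<phi> (k, x)) 0 = k" for k x
    by (simp add: \<phi>_def lookup_add lookup_sum lookup_single)
  have lookS: "Poly_Mapping.lookup (\<phi> (k, x)) (Suc (e b)) = rep x b" if "b \<in> B" for k x b
  proof -
    have "Poly_Mapping.lookup (\<phi> (k, x)) (Suc (e b)) =
        (\<Sum>b'\<in>B. if b' = b then rep x b' else 0)"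
      using e that
      by (auto simp: \<phi>_def lookup_add lookup_sum lookup_single when_def inj_on_eq_iff intro!: sum.cong)
    also have "\<dots> = rep x b" using B that by simp
    finally show ?thesis .
  qed
  have "inj \<phi>"
  proof (rule injI)
    fix p p' assume eq: "\<phi> p = \<phi> p'"
    obtain k x k' x' where p: "p = (k, x)" "p' = (k', x')" by (cases p, cases p') auto
    have "k = k'" using look0[of k x] look0[of k' x'] eq p by simp
    moreover have "rep x b = rep x' b" if "b \<in> B" for b
      using lookS[OF that, of k x] lookS[OF that, of k' x'] eq p by simp
    then have "(\<Sum>b\<in>B. zscale (rep x b) b) = (\<Sum>b\<in>B. zscale (rep x' b) b)" by simp
    then have "x = x'"
      by (simp only: rep)
    ultimately show "p = p'" using p by simp
  qed
  with add show ?thesis by blast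
qed

lemma group_algebra_no_zero_divisors:
  fixes f g :: "(int \<times> 'l::lattice_group) \<Rightarrow>\<^sub>0 complex"
  assumes "f \<noteq> 0" "g \<noteq> 0"
  shows "f * g \<noteq> 0"
proof -
  obtain \<phi> :: "int \<times> 'l \<Rightarrow> (nat \<Rightarrow>\<^sub>0 int)"
    where inj: "inj \<phi>" and add: "\<And>x y. \<phi> (x + y) = \<phi> x + \<phi> y"
    using ex_ordered_embedding by blast
  have top: "\<exists>a\<in>Poly_Mapping.keys h. \<forall>x\<in>Poly_Mapping.keys h. \<phi> x \<le> \<phi> a"
    if "h \<noteq> 0" for h :: "(int \<times> 'l) \<Rightarrow>\<^sub>0 complex"
  proof -
    have ne: "\<phi> ` Poly_Mapping.keys h \<noteq> {}" using that by simp
    have "Max (\<phi> ` Poly_Mapping.keys h) \<in> \<phi> ` Poly_Mapping.keys h"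
      using ne by (intro Max_in) auto
    then obtain a where "a \<in> Poly_Mapping.keys h" "\<phi> a = Max (\<phi> ` Poly_Mapping.keys h)" by auto
    then show ?thesis by (intro bexI[of _ a]) auto
  qed
  obtain a where a: "a \<in> Poly_Mapping.keys f" "\<And>x. x \<in> Poly_Mapping.keys f \<Longrightarrow> \<phi> x \<le> \<phi> a"
    using top[OF assms(1)] by blast
  obtain b where b: "b \<in> Poly_Mapping.keys g" "\<And>x. x \<in> Poly_Mapping.keys g \<Longrightarrow> \<phi> x \<le> \<phi> b"
    using top[OF assms(2)] by blast
  have only: "l = a \<and> m = b"
    if "l \<in> Poly_Mapping.keys f" "m \<in> Poly_Mapping.keys g" "a + b = l + m" for l m
  proof -
    have "\<phi> a + \<phi> b = \<phi> l + \<phi> m" using that(3) add by metis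
    moreover have "\<phi> l \<le> \<phi> a" "\<phi> m \<le> \<phi> b" using a(2) b(2) that by auto
    ultimately have "\<phi> l = \<phi> a \<and> \<phi> m = \<phi> b"
      by (metis add_less_le_mono add_le_less_mono order_le_less order_less_irrefl)
    then show ?thesis using inj by (simp add: inj_eq)
  qed
  have inner: "(\<Sum>m. Poly_Mapping.lookup g m when a + b = l + m) =
      (Poly_Mapping.lookup g (a + b - l))" for l
  proof -
    have "(\<lambda>m. Poly_Mapping.lookup g m when a + b = l + m) =
        (\<lambda>m. Poly_Mapping.lookup g m when m = a + b - l)"
      by (auto simp: when_def fun_eq_iff algebra_simps)
    then show ?thesis by (simp only: Sum_any_when_equal)
  qed
  have "Poly_Mapping.lookup (f * g) (a + b) =
      (\<Sum>l. Poly_Mapping.lookup f l * Poly_Mapping.lookup g (a + b - l))"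
    by (simp add: lookup_mult inner)
  also have "(\<lambda>l. Poly_Mapping.lookup f l * Poly_Mapping.lookup g (a + b - l)) =
      (\<lambda>l. (Poly_Mapping.lookup f a * Poly_Mapping.lookup g b) when l = a)"
  proof
    fix l
    show "Poly_Mapping.lookup f l * Poly_Mapping.lookup g (a + b - l) =
      ((Poly_Mapping.lookup f a * Poly_Mapping.lookup g b) when l = a)"
      using only[of l "a + b - l"] by (cases "l = a") (auto simp: in_keys_iff)
  qed
  finally have "Poly_Mapping.lookup (f * g) (a + b) = Poly_Mapping.lookup f a * Poly_Mapping.lookup g b"
    by simp
  then show ?thesis using a(1) b(1) by (auto simp: in_keys_iff)
qed

instance torus_ring :: (lattice_group) idom
  by standard (transfer, rule group_algebra_no_zero_divisors)

section \<open>Based root data\<close>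

text \<open>
  \<open>coroot \<alpha> \<mu>\<close> is the pairing of the character \<open>\<mu>\<close> with the coroot of \<open>\<alpha>\<close>; the cocharacter
  lattice is identified with the dual of the character lattice \<open>'l\<close>. The reduced root data
  are exactly those of the pairs \<open>(G, T)\<close> with \<open>G\<close> a connected complex reductive group. Only
  the values of \<open>coroot\<close> at roots matter.
\<close>

definition reflection :: "('l \<Rightarrow> 'l \<Rightarrow> int) \<Rightarrow> 'l \<Rightarrow> 'l \<Rightarrow> 'l::lattice_group" where
  "reflection coroot \<alpha> \<mu> = \<mu> - zscale (coroot \<alpha> \<mu>) \<alpha>"

locale root_datum =
  fixes \<Phi> :: "'l::lattice_group set" and coroot :: "'l \<Rightarrow> 'l \<Rightarrow> int"
  assumes finite_roots: "finite \<Phi>"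
    and coroot_add: "\<alpha> \<in> \<Phi> \<Longrightarrow> coroot \<alpha> (\<mu> + \<nu>) = coroot \<alpha> \<mu> + coroot \<alpha> \<nu>"
    and coroot_self: "\<alpha> \<in> \<Phi> \<Longrightarrow> coroot \<alpha> \<alpha> = 2"
    and coroot_inj: "inj_on coroot \<Phi>"
    and refl_root: "\<alpha> \<in> \<Phi> \<Longrightarrow> \<beta> \<in> \<Phi> \<Longrightarrow> reflection coroot \<alpha> \<beta> \<in> \<Phi>"
    and refl_coroot: "\<alpha> \<in> \<Phi> \<Longrightarrow> \<beta> \<in> \<Phi> \<Longrightarrow>
          (\<lambda>\<mu>. coroot \<beta> \<mu> - coroot \<beta> \<alpha> * coroot \<alpha> \<mu>) \<in> coroot ` \<Phi>"
    and reduced: "\<alpha> \<in> \<Phi> \<Longrightarrow> \<beta> \<in> \<Phi> \<Longrightarrow> n \<noteq> 0 \<Longrightarrow> zscale m \<alpha> = zscale n \<beta> \<Longrightarrow> \<beta> = \<alpha> \<or> \<beta> = - \<alpha>"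

text \<open>\<open>\<Delta>\<close> is the set of simple roots.\<close>

locale based_root_datum = root_datum \<Phi> coroot
  for \<Phi> :: "'l::lattice_group set" and coroot :: "'l \<Rightarrow> 'l \<Rightarrow> int" +
  fixes \<Delta> :: "'l set"
  assumes simple_subset: "\<Delta> \<subseteq> \<Phi>"
    and simple_independent: "zmod.independent \<Delta>"
    and root_simple_sum: "\<beta> \<in> \<Phi> \<Longrightarrow>
          \<exists>c. \<beta> = (\<Sum>\<alpha>\<in>\<Delta>. zscale (c \<alpha>) \<alpha>) \<and> ((\<forall>\<alpha>\<in>\<Delta>. 0 \<le> c \<alpha>) \<or> (\<forall>\<alpha>\<in>\<Delta>. c \<alpha> \<le> 0))"

definition pos_roots :: "'l::lattice_group set \<Rightarrow> 'l set \<Rightarrow> 'l set" where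
  "pos_roots \<Phi> \<Delta> = {\<beta> \<in> \<Phi>. \<exists>c. (\<forall>\<alpha>\<in>\<Delta>. 0 \<le> c \<alpha>) \<and> \<beta> = (\<Sum>\<alpha>\<in>\<Delta>. zscale (c \<alpha>) \<alpha>)}"

text \<open>
  The Weyl group acts faithfully on the character lattice and is represented by the group of
  transformations of \<open>'l\<close> generated by the reflections in the roots; its product is \<open>(\<circ>)\<close>.
\<close>

inductive_set weyl :: "'l::lattice_group set \<Rightarrow> ('l \<Rightarrow> 'l \<Rightarrow> int) \<Rightarrow> ('l \<Rightarrow> 'l) set"
  for \<Phi> coroot where
  weyl_id: "id \<in> weyl \<Phi> coroot"
| weyl_refl: "\<lbrakk>w \<in> weyl \<Phi> coroot; \<alpha> \<in> \<Phi>\<rbrakk> \<Longrightarrow> reflection coroot \<alpha> \<circ> w \<in> weyl \<Phi> coroot"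

definition weyl_length :: "('l::lattice_group \<Rightarrow> 'l \<Rightarrow> int) \<Rightarrow> 'l set \<Rightarrow> ('l \<Rightarrow> 'l) \<Rightarrow> nat" where
  "weyl_length coroot \<Delta> w =
     (LEAST n. \<exists>\<alpha>s. set \<alpha>s \<subseteq> \<Delta> \<and> length \<alpha>s = n \<and> w = foldr (\<lambda>\<alpha> x. reflection coroot \<alpha> \<circ> x) \<alpha>s id)"

definition bruhat_step ::
  "'l::lattice_group set \<Rightarrow> ('l \<Rightarrow> 'l \<Rightarrow> int) \<Rightarrow> 'l set \<Rightarrow> ('l \<Rightarrow> 'l) \<Rightarrow> ('l \<Rightarrow> 'l) \<Rightarrow> bool" where
  "bruhat_step \<Phi> coroot \<Delta> u v \<longleftrightarrow>
     u \<in> weyl \<Phi> coroot \<and> (\<exists>\<alpha>\<in>\<Phi>. v = u \<circ> reflection coroot \<alpha>) \<and>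
     weyl_length coroot \<Delta> u < weyl_length coroot \<Delta> v"

definition bruhat_le ::
  "'l::lattice_group set \<Rightarrow> ('l \<Rightarrow> 'l \<Rightarrow> int) \<Rightarrow> 'l set \<Rightarrow> ('l \<Rightarrow> 'l) \<Rightarrow> ('l \<Rightarrow> 'l) \<Rightarrow> bool" where
  "bruhat_le \<Phi> coroot \<Delta> = (bruhat_step \<Phi> coroot \<Delta>)\<^sup>*\<^sup>*"

definition bruhat_less ::
  "'l::lattice_group set \<Rightarrow> ('l \<Rightarrow> 'l \<Rightarrow> int) \<Rightarrow> 'l set \<Rightarrow> ('l \<Rightarrow> 'l) \<Rightarrow> ('l \<Rightarrow> 'l) \<Rightarrow> bool" where
  "bruhat_less \<Phi> coroot \<Delta> u v \<longleftrightarrow> bruhat_le \<Phi> coroot \<Delta> u v \<and> u \<noteq> v"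

section \<open>Deformed R-polynomials\<close>

text \<open>
  \<open>\<int>[q, q\<^sup>-\<^sup>1] \<otimes> \<O>(T)\<close> with all \<open>1 - y\<^sup>\<alpha>\<close>, \<open>\<alpha>\<close> a positive root, inverted, as a subring of
  the field of fractions.
\<close>

definition localized_ring ::
  "'l::lattice_group set \<Rightarrow> 'l set \<Rightarrow> 'l torus_ring fract set" where
  "localized_ring \<Phi> \<Delta> =
     {to_fract f / to_fract (\<Prod>\<alpha>\<in>pos_roots \<Phi> \<Delta>. (1 - ychar \<alpha>) ^ k \<alpha>) | f k. True}"

text \<open>
  The properties that determine the family \<open>r u v\<close> for \<open>u\<close>, \<open>v\<close> in the Weyl group; other
  values of \<open>r\<close> are unconstrained.
\<close>

definition is_deformed_R ::
  "'l::lattice_group set \<Rightarrow> ('l \<Rightarrow> 'l \<Rightarrow> int) \<Rightarrow> 'l set \<Rightarrow>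
   (('l \<Rightarrow> 'l) \<Rightarrow> ('l \<Rightarrow> 'l) \<Rightarrow> 'l torus_ring fract) \<Rightarrow> bool" where
  "is_deformed_R \<Phi> coroot \<Delta> r \<longleftrightarrow>
     (\<forall>u\<in>weyl \<Phi> coroot. \<forall>v\<in>weyl \<Phi> coroot. r u v \<in> localized_ring \<Phi> \<Delta>) \<and>
     (\<forall>u\<in>weyl \<Phi> coroot. \<forall>v\<in>weyl \<Phi> coroot. \<not> bruhat_le \<Phi> coroot \<Delta> u v \<longrightarrow> r u v = 0) \<and>
     (\<forall>v\<in>weyl \<Phi> coroot. r v v = 1) \<and>
     (\<forall>u\<in>weyl \<Phi> coroot. \<forall>v\<in>weyl \<Phi> coroot. \<forall>\<alpha>\<in>\<Delta>.
        let s = reflection coroot \<alpha>; Y = to_fract (ychar (- (inv v \<alpha>))); Q = to_fract qvar in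
        bruhat_less \<Phi> coroot \<Delta> (s \<circ> v) v \<longrightarrow>
          (bruhat_less \<Phi> coroot \<Delta> (s \<circ> u) u \<longrightarrow>
             r u v = (1 - Q) / (1 - Y) * r u (s \<circ> v) + r (s \<circ> u) (s \<circ> v)) \<and>
          (bruhat_less \<Phi> coroot \<Delta> u (s \<circ> u) \<longrightarrow>
             r u v = (1 - Q) * (Y / (1 - Y)) * r u (s \<circ> v) + Q * r (s \<circ> u) (s \<circ> v)))"

definition S_set ::
  "'l::lattice_group set \<Rightarrow> ('l \<Rightarrow> 'l \<Rightarrow> int) \<Rightarrow> 'l set \<Rightarrow> ('l \<Rightarrow> 'l) \<Rightarrow> ('l \<Rightarrow> 'l) \<Rightarrow> 'l set" where
  "S_set \<Phi> coroot \<Delta> u v =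
     {\<alpha> \<in> pos_roots \<Phi> \<Delta>. bruhat_le \<Phi> coroot \<Delta> u (v \<circ> reflection coroot \<alpha>) \<and>
                          bruhat_less \<Phi> coroot \<Delta> (v \<circ> reflection coroot \<alpha>) v}"

end

theory Submission
  imports Defs
begin

text \<open>
  The recursion says that \<open>r\<^sub>\<cdot>\<^sub>,\<^sub>v\<close>, as a function of its first index, arises from \<open>r\<^sub>\<cdot>\<^sub>,\<^sub>s\<^sub>v\<close> by an
  operator (\<open>intertwiner\<close>) that is left multiplication by \<open>T\<^sub>s + (1 - q) y\<^sup>\<gamma> / (1 - y\<^sup>\<gamma>)\<close> in a Hecke
  algebra. So the only possible poles are simple ones along \<open>y\<^sup>\<beta> = 1\<close> for the inversions \<open>\<beta>\<close> of \<open>v\<close>,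
  that is, for the positive roots with \<open>v \<beta> < 0\<close> (\<open>r_regular\<close>). Bounding the poles of the two
  terms of the recursion separately is not enough: for \<open>u = s\<^sub>1\<close>, \<open>v = s\<^sub>1 s\<^sub>2 s\<^sub>1\<close> in type A2 both
  terms have a pole along a root outside \<open>S(u, v)\<close>, and these cancel.

  The cancellation is explained by the residue along \<open>y\<^sup>\<beta> = 1\<close> (\<open>r_residue\<close>). Write \<open>v\<close> as a
  reduced word; the residue replaces one factor of the product of intertwiners by a scalar. On
  \<open>y\<^sup>\<beta> = 1\<close> a character \<open>\<mu>\<close> equals \<open>r\<^sub>\<beta> \<mu>\<close>, hence the parameters of the remaining factors are those
  that belong to the word, with that letter omitted, of \<open>v r\<^sub>\<beta>\<close>. This word need not be reduced, but
  intertwiners with opposite parameters multiply to scalars (\<open>intertwiner_opposite\<close>). Therefore the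
  residue of \<open>r\<^sub>u\<^sub>,\<^sub>v\<close> is \<open>\<kappa> r\<^sub>u\<^sub>,\<^sub>w\<close> with \<open>w = v r\<^sub>\<beta>\<close> and a regular \<open>\<kappa>\<close> that does not depend on \<open>u\<close>. It
  vanishes unless \<open>u \<le> v r\<^sub>\<beta>\<close>, and since \<open>v r\<^sub>\<beta> < v\<close> for every inversion \<open>\<beta>\<close>, a pole along
  \<open>y\<^sup>\<beta> = 1\<close> forces \<open>\<beta> \<in> S(u, v)\<close>.

  "Along \<open>y\<^sup>\<beta> = 1\<close>" is made precise by fractions whose denominator is not a zero divisor modulo
  \<open>1 - y\<^sup>\<beta>\<close> (\<open>regular_along\<close>). The factor \<open>1 - y\<^sup>\<gamma>\<close> of any other positive root \<open>\<gamma>\<close> is allowed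
  there (\<open>one_minus_ychar_cancel\<close>), so the roots do not interfere. A fraction whose denominator is a
  product of powers of the \<open>1 - y\<^sup>\<beta>\<close>, and which is regular along every \<open>y\<^sup>\<beta> = 1\<close>, is a regular
  function on the torus (\<open>regular_everywhere\<close>).
\<close>

section \<open>Divisibility by one minus a character\<close>

lemma zscale_eq_0_iff [simp]: "zscale n (x::'l::lattice_group) = 0 \<longleftrightarrow> n = 0 \<or> x = 0"
proof
  assume nx: "zscale n x = 0"
  obtain B :: "'l set" where
    ex1: "\<And>y. \<exists>!c. (\<forall>b. b \<notin> B \<longrightarrow> c b = 0) \<and> y = (\<Sum>b\<in>B. zscale (c b) b)"
    using ex_finite_basis by blast
  define is_coord where
    "is_coord y c \<longleftrightarrow> (\<forall>b. b \<notin> B \<longrightarrow> c b = 0) \<and> y = (\<Sum>b\<in>B. zscale (c b) b)" for y c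
  have coord: "\<exists>!c. is_coord y c" for y unfolding is_coord_def by (rule ex1)
  then obtain c where c: "is_coord x c" by blast
  then have "is_coord 0 (\<lambda>b. n * c b)"
    using nx by (simp add: is_coord_def zmod.scale_sum_right)
  moreover have "is_coord 0 (\<lambda>b. 0)" by (simp add: is_coord_def)
  ultimately have "(\<lambda>b. n * c b) = (\<lambda>b. 0)" using coord by blast
  then have "n = 0 \<or> (\<forall>b. c b = 0)" by (metis mult_eq_0_iff)
  then show "n = 0 \<or> x = 0" using c by (auto simp: is_coord_def)
qed auto

text \<open>
  Restricting a function on the torus to the subgroup \<open>y\<^sup>b = 1\<close> identifies the characters that
  differ by a multiple of \<open>b\<close>. Its coefficient at the coset of \<open>p\<close> modulo \<open>\<int>b\<close> is this sum, written
  without the quotient group so that torsion in the quotient needs no separate treatment.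
\<close>

definition coset_sum :: "'g::ab_group_add \<Rightarrow> ('g \<Rightarrow>\<^sub>0 'k::comm_ring_1) \<Rightarrow> 'g \<Rightarrow> 'k" where
  "coset_sum b f p =
     (\<Sum>k\<in>Poly_Mapping.keys f. if \<exists>m. k = p + zscale m b then Poly_Mapping.lookup f k else 0)"

lemma coset_sum_superset:
  assumes "finite A" "Poly_Mapping.keys f \<subseteq> A"
  shows "coset_sum b f p = (\<Sum>k\<in>A. if \<exists>m. k = p + zscale m b then Poly_Mapping.lookup f k else 0)"
  unfolding coset_sum_def using assms
  by (intro sum.mono_neutral_left) (auto simp: in_keys_iff)

lemma coset_sum_diff: "coset_sum b (f - g) p = coset_sum b f p - coset_sum b g p"
proof -
  let ?A = "Poly_Mapping.keys f \<union> Poly_Mapping.keys g"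
  have "Poly_Mapping.keys (f - g) \<subseteq> ?A"
    by (auto simp: in_keys_iff lookup_minus)
  then show ?thesis
    by (simp add: coset_sum_superset[of ?A] lookup_minus sum_subtractf[symmetric])
      (intro sum.cong, auto simp: lookup_minus)
qed

lemma lookup_shift:
  fixes f :: "'g::ab_group_add \<Rightarrow>\<^sub>0 'k::comm_ring_1"
  shows "Poly_Mapping.lookup (Poly_Mapping.single c 1 * f) k = Poly_Mapping.lookup f (k - c)"
proof -
  have inner: "(\<Sum>m. Poly_Mapping.lookup f m when k = l + m) = Poly_Mapping.lookup f (k - l)" for l
  proof -
    have "(\<lambda>m. Poly_Mapping.lookup f m when k = l + m) =
        (\<lambda>m. Poly_Mapping.lookup f m when m = k - l)"
      by (auto simp: when_def fun_eq_iff algebra_simps)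
    then show ?thesis by (simp only: Sum_any_when_equal)
  qed
  have "(\<lambda>l. Poly_Mapping.lookup (Poly_Mapping.single c (1::'k)) l * Poly_Mapping.lookup f (k - l)) =
      (\<lambda>l. Poly_Mapping.lookup f (k - l) when l = c)"
    by (auto simp: lookup_single when_def fun_eq_iff)
  then have "(\<Sum>l. Poly_Mapping.lookup (Poly_Mapping.single c (1::'k)) l * Poly_Mapping.lookup f (k - l)) =
      Poly_Mapping.lookup f (k - c)"
    by (simp only: Sum_any_when_equal)
  then show ?thesis unfolding lookup_mult inner .
qed

lemma coset_sum_shift:
  "coset_sum b (Poly_Mapping.single c 1 * f) p = coset_sum b f (p - c)"
proof -
  let ?g = "Poly_Mapping.single c 1 * f"
  have keys: "Poly_Mapping.keys ?g = (\<lambda>k. k + c) ` Poly_Mapping.keys f"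
  proof (intro set_eqI iffI)
    fix k assume "k \<in> Poly_Mapping.keys ?g"
    then have "k - c \<in> Poly_Mapping.keys f" by (simp add: in_keys_iff lookup_shift)
    then show "k \<in> (\<lambda>k. k + c) ` Poly_Mapping.keys f"
      by (intro image_eqI[of _ _ "k - c"]) auto
  qed (auto simp: in_keys_iff lookup_shift)
  have iff: "k + c = p + z \<longleftrightarrow> k = p - c + z" for k z by (auto simp: algebra_simps)
  show ?thesis
    unfolding coset_sum_def keys
    by (subst sum.reindex) (auto simp: inj_on_def lookup_shift iff intro!: sum.cong)
qed

lemma coset_sum_translate: "coset_sum b f (p + zscale n b) = coset_sum b f p"
proof -
  have "(\<exists>m. k = p + zscale n b + zscale m b) \<longleftrightarrow> (\<exists>m. k = p + zscale m b)" for k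
  proof
    assume "\<exists>m. k = p + zscale n b + zscale m b"
    then show "\<exists>m. k = p + zscale m b" by (metis add.assoc zscale_add_left)
  next
    assume "\<exists>m. k = p + zscale m b"
    then obtain m where "k = p + zscale m b" ..
    then have "k = p + zscale n b + zscale (m - n) b"
      by (simp add: zmod.scale_left_diff_distrib)
    then show "\<exists>m. k = p + zscale n b + zscale m b" ..
  qed
  then show ?thesis by (simp add: coset_sum_def)
qed

lemma one_minus_dvd_single_diff:
  "1 - Poly_Mapping.single b 1 dvd
     Poly_Mapping.single (k + zscale m b) a - Poly_Mapping.single k (a::'k::comm_ring_1)"
proof -
  let ?d = "1 - Poly_Mapping.single b (1::'k)"
  have nat: "?d dvd Poly_Mapping.single (k + zscale (int n) b) a - Poly_Mapping.single k a" for n k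
  proof (induction n)
    case (Suc n)
    have "Poly_Mapping.single (k + zscale (int (Suc n)) b) a - Poly_Mapping.single k a =
        (Poly_Mapping.single (k + zscale (int n) b) a - Poly_Mapping.single k a) -
        ?d * Poly_Mapping.single (k + zscale (int n) b) a"
      by (simp add: left_diff_distrib mult_single zscale_add_left zscale_one algebra_simps)
    then show ?case using Suc by (metis dvd_diff dvd_triv_left)
  qed simp
  show ?thesis
  proof (cases "m \<ge> 0")
    case True then show ?thesis using nat[of k "nat m"] by simp
  next
    case False
    then show ?thesis
      using nat[of "k + zscale m b" "nat (- m)"]
      by (subst dvd_minus_iff[symmetric]) (simp add: zmod.scale_minus_left add.assoc)
  qed
qed

text \<open>
  The ideal of the subgroup \<open>y\<^sup>b = 1\<close> is principal: modulo \<open>1 - y\<^sup>b\<close> every monomial can be moved to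
  a fixed representative of its coset, and what remains is recorded by the coset sums.
\<close>

lemma one_minus_single_dvd_iff:
  fixes f :: "'g::ab_group_add \<Rightarrow>\<^sub>0 'k::comm_ring_1"
  shows "1 - Poly_Mapping.single b 1 dvd f \<longleftrightarrow> (\<forall>p. coset_sum b f p = 0)"
proof
  assume "1 - Poly_Mapping.single b 1 dvd f"
  then obtain h where "f = h - Poly_Mapping.single b 1 * h"
    by (auto simp: dvd_def left_diff_distrib)
  then show "\<forall>p. coset_sum b f p = 0"
    using coset_sum_translate[of b h _ "-1"]
    by (simp add: coset_sum_diff coset_sum_shift zscale_minus_left zscale_one)
next
  assume zero: "\<forall>p. coset_sum b f p = 0"
  let ?d = "1 - Poly_Mapping.single b (1::'k)"
  define rep where "rep k = (SOME p. \<exists>m. k = p + zscale m b)" for k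
  have rep: "\<exists>m. k = rep k + zscale m b" for k
    unfolding rep_def by (rule someI[of _ k]) (auto intro: exI[of _ 0])
  have rep_cong: "rep x = rep y" if x: "x = y + zscale i b" for x y i
  proof -
    have "(\<exists>m. x = p + zscale m b) \<longleftrightarrow> (\<exists>m. y = p + zscale m b)" for p
    proof
      assume "\<exists>m. x = p + zscale m b"
      then obtain m where "x = p + zscale m b" ..
      then have "y = p + zscale (m - i) b"
        using x by (simp add: zmod.scale_left_diff_distrib algebra_simps)
      then show "\<exists>m. y = p + zscale m b" ..
    next
      assume "\<exists>m. y = p + zscale m b"
      then show "\<exists>m. x = p + zscale m b" using x by (metis add.assoc zscale_add_left)
    qed
    then show ?thesis by (simp add: rep_def)
  qed
  have rep_rep: "rep (rep k) = rep k" for k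
    using rep rep_cong by metis
  have rep_eq: "rep k = p \<longleftrightarrow> (\<exists>m. k = p + zscale m b)" if "rep p = p" for k p
    using rep rep_cong that by metis
  let ?K = "Poly_Mapping.keys f"
  let ?g = "\<Sum>k\<in>?K. Poly_Mapping.single (rep k) (Poly_Mapping.lookup f k)"
  have "f = (\<Sum>k\<in>?K. Poly_Mapping.single k (Poly_Mapping.lookup f k))"
    by (rule poly_mapping_eqI) (simp add: lookup_sum lookup_single when_def in_keys_iff)
  then have "f - ?g = (\<Sum>k\<in>?K. Poly_Mapping.single k (Poly_Mapping.lookup f k) -
      Poly_Mapping.single (rep k) (Poly_Mapping.lookup f k))"
    by (simp add: sum_subtractf)
  moreover have "?d dvd Poly_Mapping.single k a - Poly_Mapping.single (rep k) a" for k a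
    using rep[of k] one_minus_dvd_single_diff[of b "rep k" _ a] by metis
  ultimately have "?d dvd f - ?g" by (simp add: dvd_sum)
  moreover have "?g = 0"
  proof (rule poly_mapping_eqI)
    fix p
    have "Poly_Mapping.lookup ?g p = (\<Sum>k\<in>?K. if rep k = p then Poly_Mapping.lookup f k else 0)"
      by (simp add: lookup_sum lookup_single when_def)
    also have "\<dots> = 0"
    proof (cases "rep p = p")
      case True
      then show ?thesis using zero by (simp add: rep_eq coset_sum_def)
    next
      case False
      then have "rep k \<noteq> p" for k using rep_rep by metis
      then show ?thesis by simp
    qed
    finally show "Poly_Mapping.lookup ?g p = Poly_Mapping.lookup 0 p" by simp
  qed
  ultimately show "?d dvd f" by simp
qed

text \<open>
  Multiplying by \<open>1 - y\<^sup>c\<close> takes differences of coset sums in the direction \<open>c\<close>. If the product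
  vanishes on \<open>y\<^sup>b = 1\<close>, the coset sums of \<open>f\<close> are therefore invariant under translation by \<open>c\<close>.
  Translates by multiples of \<open>c\<close> meet infinitely many cosets, while \<open>f\<close> has finite support, so
  the coset sums are zero.
\<close>

lemma one_minus_single_cancel:
  fixes f :: "'g::ab_group_add \<Rightarrow>\<^sub>0 'k::comm_ring_1"
  assumes indep: "\<And>m n. n \<noteq> 0 \<Longrightarrow> zscale n c \<noteq> zscale m b"
    and dvd: "1 - Poly_Mapping.single b 1 dvd (1 - Poly_Mapping.single c 1) * f"
  shows "1 - Poly_Mapping.single b 1 dvd f"
  unfolding one_minus_single_dvd_iff
proof
  fix p
  have shift: "coset_sum b f (x - c) = coset_sum b f x" for x
    using dvd by (simp add: one_minus_single_dvd_iff left_diff_distrib coset_sum_diff coset_sum_shift)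
  have shifts: "coset_sum b f (p - zscale (int n) c) = coset_sum b f p" for n
  proof (induction n)
    case (Suc n)
    then show ?case
      using shift[of "p - zscale (int n) c"]
      by (simp add: zscale_add_left zscale_one algebra_simps)
  qed simp
  \<comment> \<open>\<open>N k\<close>: the multiples of \<open>c\<close> whose translate of \<open>p\<close> falls into the coset of \<open>k\<close>; at most one
    by independence.\<close>
  define N where "N k = {n. \<exists>m. k = p - zscale (int n) c + zscale m b}" for k
  have "finite (N k)" for k
  proof -
    have "n = n'" if nn': "n \<in> N k" "n' \<in> N k" for n n'
    proof (rule ccontr)
      assume "n \<noteq> n'"
      obtain m where m: "k = p - zscale (int n) c + zscale m b"
        using nn'(1) unfolding N_def by blast
      obtain m' where m': "k = p - zscale (int n') c + zscale m' b"
        using nn'(2) unfolding N_def by blast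
      then have "p - zscale (int n) c + zscale m b = p - zscale (int n') c + zscale m' b"
        using m m' by simp
      then have "zscale (int n - int n') c = zscale (m - m') b"
        by (simp add: zmod.scale_left_diff_distrib algebra_simps)
      then show False using indep[of "int n - int n'" "m - m'"] \<open>n \<noteq> n'\<close> by simp
    qed
    then have "N k = {} \<or> (\<exists>n. N k = {n})" by blast
    then show ?thesis by auto
  qed
  then have "finite (\<Union>k\<in>Poly_Mapping.keys f. N k)" by simp
  then obtain n where "n \<notin> (\<Union>k\<in>Poly_Mapping.keys f. N k)"
    using ex_new_if_finite infinite_UNIV_nat by blast
  then have "coset_sum b f (p - zscale (int n) c) = 0"
    by (auto simp: coset_sum_def N_def intro!: sum.neutral)
  then show "coset_sum b f p = 0" using shifts by metis
qed

lemma zscale_Pair_0: "zscale n (0::int, \<mu>::'l::lattice_group) = (0, zscale n \<mu>)"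
proof -
  have "(\<Sum>i<k. (0::int, \<mu>)) = (0, \<Sum>i<k. \<mu>)" for k :: nat
    by (induction k) (auto simp: zero_prod_def)
  then show ?thesis by (simp add: zscale_def)
qed

lemmas torus_ring_rep_eqs =
  ychar.rep_eq one_torus_ring.rep_eq minus_torus_ring.rep_eq times_torus_ring.rep_eq

lemma one_minus_ychar_dvd_iff:
  "1 - ychar \<beta> dvd f \<longleftrightarrow> 1 - Poly_Mapping.single (0, \<beta>) 1 dvd Rep_torus_ring f"
proof
  assume "1 - ychar \<beta> dvd f"
  then obtain h where "f = (1 - ychar \<beta>) * h" by (rule dvdE)
  then have "Rep_torus_ring f = (1 - Poly_Mapping.single (0, \<beta>) 1) * Rep_torus_ring h"
    by (simp only: torus_ring_rep_eqs)
  then show "1 - Poly_Mapping.single (0, \<beta>) 1 dvd Rep_torus_ring f" by (rule dvdI)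
next
  assume "1 - Poly_Mapping.single (0, \<beta>) 1 dvd Rep_torus_ring f"
  then obtain h where "Rep_torus_ring f = (1 - Poly_Mapping.single (0, \<beta>) 1) * h" by (rule dvdE)
  then have "Rep_torus_ring f = Rep_torus_ring ((1 - ychar \<beta>) * Abs_torus_ring h)"
    by (simp only: torus_ring_rep_eqs Abs_torus_ring_inverse UNIV_I)
  then show "1 - ychar \<beta> dvd f" unfolding Rep_torus_ring_inject by (rule dvdI)
qed

text \<open>
  Two subtori \<open>y\<^sup>\<beta> = 1\<close> and \<open>y\<^sup>\<gamma> = 1\<close> with independent \<open>\<beta>\<close>, \<open>\<gamma>\<close> have no common component. This
  replaces coprimality of irreducible factors: \<open>1 - y\<^sup>\<beta>\<close> need not be irreducible, since \<open>\<beta>\<close> may be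
  divisible in the character lattice.
\<close>

lemma one_minus_ychar_cancel:
  fixes \<beta> \<gamma> :: "'l::lattice_group"
  assumes indep: "\<And>m n. n \<noteq> 0 \<Longrightarrow> zscale n \<gamma> \<noteq> zscale m \<beta>"
    and dvd: "1 - ychar \<beta> dvd (1 - ychar \<gamma>) * f"
  shows "1 - ychar \<beta> dvd f"
proof -
  have "zscale n (0, \<gamma>) \<noteq> zscale m (0::int, \<beta>)" if "n \<noteq> 0" for m n
    using indep[OF that] by (simp add: zscale_Pair_0)
  moreover have "1 - Poly_Mapping.single (0, \<beta>) 1 dvd
      (1 - Poly_Mapping.single (0, \<gamma>) 1) * Rep_torus_ring f"
    using dvd unfolding one_minus_ychar_dvd_iff torus_ring_rep_eqs .
  ultimately show ?thesis
    unfolding one_minus_ychar_dvd_iff by (rule one_minus_single_cancel)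
qed

lemma ychar_0 [simp]: "ychar 0 = 1"
proof -
  have "Rep_torus_ring (ychar (0::'a)) = Rep_torus_ring 1"
    by (simp only: torus_ring_rep_eqs zero_prod_def[symmetric] single_one)
  then show ?thesis unfolding Rep_torus_ring_inject .
qed

lemma ychar_add: "ychar (\<mu> + \<nu>) = ychar \<mu> * ychar \<nu>"
proof -
  have "Rep_torus_ring (ychar (\<mu> + \<nu>)) = Rep_torus_ring (ychar \<mu> * ychar \<nu>)"
    by (simp add: torus_ring_rep_eqs mult_single)
  then show ?thesis unfolding Rep_torus_ring_inject .
qed

lemma ychar_eq_1_iff [simp]: "ychar \<mu> = 1 \<longleftrightarrow> \<mu> = 0"
proof
  assume "ychar \<mu> = 1"
  then have "Rep_torus_ring (ychar \<mu>) = Rep_torus_ring 1" by simp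
  then have "Poly_Mapping.single (0::int, \<mu>) (1::complex) = 1"
    by (simp only: torus_ring_rep_eqs)
  then have "Poly_Mapping.keys (Poly_Mapping.single (0::int, \<mu>) (1::complex)) = Poly_Mapping.keys (1::int \<times> 'a \<Rightarrow>\<^sub>0 complex)"
    by (simp only:)
  then show "\<mu> = 0" by (simp add: zero_prod_def)
qed simp

text \<open>
  On \<open>y\<^sup>\<beta> = 1\<close> the characters \<open>\<mu>\<close> and \<open>r\<^sub>\<beta> \<mu>\<close> agree, because they differ by a
  multiple of \<open>\<beta>\<close>.
\<close>

lemma one_minus_ychar_dvd_shift: "1 - ychar \<beta> dvd ychar (\<mu> + zscale m \<beta>) - ychar \<mu>"
  unfolding one_minus_ychar_dvd_iff torus_ring_rep_eqs
  using one_minus_dvd_single_diff[of "(0::int, \<beta>)" "(0, \<mu>)" m "1::complex"]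
  by (simp add: zscale_Pair_0)

section \<open>Roots, lengths and the Bruhat order\<close>

context root_datum
begin

lemma coroot_zero [simp]: "\<alpha> \<in> \<Phi> \<Longrightarrow> coroot \<alpha> 0 = 0"
  using coroot_add[of \<alpha> 0 0] by simp

lemma coroot_uminus [simp]: "\<alpha> \<in> \<Phi> \<Longrightarrow> coroot \<alpha> (- \<mu>) = - coroot \<alpha> \<mu>"
  using coroot_add[of \<alpha> \<mu> "- \<mu>"] by simp

lemma coroot_diff [simp]: "\<alpha> \<in> \<Phi> \<Longrightarrow> coroot \<alpha> (\<mu> - \<nu>) = coroot \<alpha> \<mu> - coroot \<alpha> \<nu>"
  using coroot_add[of \<alpha> \<mu> "- \<nu>"] by simp

lemma coroot_zscale [simp]:
  assumes "\<alpha> \<in> \<Phi>"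
  shows "coroot \<alpha> (zscale n \<mu>) = n * coroot \<alpha> \<mu>"
proof (induction n rule: int_induct[where k = 0])
  case base
  then show ?case using assms by simp
next
  case (step1 i)
  then show ?case using assms by (simp add: zscale_add_left zscale_one coroot_add algebra_simps)
next
  case (step2 i)
  then show ?case
    using assms by (simp add: zmod.scale_left_diff_distrib zscale_one algebra_simps)
qed

lemma coroot_sum: "\<alpha> \<in> \<Phi> \<Longrightarrow> coroot \<alpha> (\<Sum>i\<in>I. f i) = (\<Sum>i\<in>I. coroot \<alpha> (f i))"
  by (induction I rule: infinite_finite_induct) (auto simp: coroot_add)

lemma root_nonzero: "\<alpha> \<in> \<Phi> \<Longrightarrow> \<alpha> \<noteq> 0"
  using coroot_self coroot_zero by force

lemma refl_self: "\<alpha> \<in> \<Phi> \<Longrightarrow> reflection coroot \<alpha> \<alpha> = - \<alpha>"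
  using zscale_add_left[of 1 1 \<alpha>] by (simp add: reflection_def coroot_self zscale_one)

lemma uminus_root: "\<alpha> \<in> \<Phi> \<Longrightarrow> - \<alpha> \<in> \<Phi>"
  using refl_root[of \<alpha> \<alpha>] by (simp add: refl_self)

lemma refl_involution: "\<alpha> \<in> \<Phi> \<Longrightarrow> reflection coroot \<alpha> (reflection coroot \<alpha> \<mu>) = \<mu>"
  by (simp add: reflection_def coroot_self algebra_simps zmod.scale_left_diff_distrib)

lemma refl_comp_refl: "\<alpha> \<in> \<Phi> \<Longrightarrow> reflection coroot \<alpha> \<circ> reflection coroot \<alpha> = id"
  by (simp add: fun_eq_iff refl_involution)

lemma refl_add:
  "\<alpha> \<in> \<Phi> \<Longrightarrow> reflection coroot \<alpha> (\<mu> + \<nu>) = reflection coroot \<alpha> \<mu> + reflection coroot \<alpha> \<nu>"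
  by (simp add: reflection_def coroot_add zscale_add_left)

lemma refl_zscale:
  "\<alpha> \<in> \<Phi> \<Longrightarrow> reflection coroot \<alpha> (zscale n \<mu>) = zscale n (reflection coroot \<alpha> \<mu>)"
  by (simp add: reflection_def zmod.scale_right_diff_distrib zscale_mult)

lemma refl_diff:
  "\<alpha> \<in> \<Phi> \<Longrightarrow> reflection coroot \<alpha> (\<mu> - \<nu>) = reflection coroot \<alpha> \<mu> - reflection coroot \<alpha> \<nu>"
  using refl_add[of \<alpha> "\<mu> - \<nu>" \<nu>] by simp

text \<open>
  The axioms say only that \<open>\<mu> \<mapsto> \<langle>r\<^sub>\<alpha> \<mu>, \<beta>\<^sup>\<or>\<rangle>\<close> is the coroot of some root \<open>\<epsilon>\<close>. Put \<open>\<delta> = r\<^sub>\<alpha> \<beta>\<close>. The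
  reflections \<open>r\<^sub>\<epsilon>\<close> and \<open>r\<^sub>\<alpha> r\<^sub>\<beta> r\<^sub>\<alpha>\<close> are given by the same functional and the vectors \<open>\<epsilon>\<close>, \<open>\<delta>\<close>, so
  their product translates \<open>x\<close> by a multiple of \<open>\<epsilon> - \<delta>\<close>, and it preserves \<open>\<Phi>\<close>. Its powers would
  move \<open>\<epsilon>\<close> through infinitely many roots unless \<open>\<epsilon> = \<delta>\<close>.
\<close>

lemma coroot_refl:
  assumes "\<alpha> \<in> \<Phi>" "\<beta> \<in> \<Phi>"
  shows "coroot (reflection coroot \<alpha> \<beta>) \<mu> = coroot \<beta> (reflection coroot \<alpha> \<mu>)"
proof -
  define \<delta> where "\<delta> = reflection coroot \<alpha> \<beta>"
  obtain \<epsilon> where \<epsilon>: "\<epsilon> \<in> \<Phi>" and "coroot \<epsilon> = (\<lambda>\<mu>. coroot \<beta> \<mu> - coroot \<beta> \<alpha> * coroot \<alpha> \<mu>)"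
    using refl_coroot[OF assms] by (metis (no_types, lifting) image_iff)
  then have coroot_\<epsilon>: "coroot \<epsilon> \<mu> = coroot \<beta> (reflection coroot \<alpha> \<mu>)" for \<mu>
    using assms by (simp add: reflection_def)
  have \<epsilon>\<delta>: "coroot \<epsilon> \<delta> = 2"
    using assms by (simp add: coroot_\<epsilon> \<delta>_def refl_involution coroot_self)
  have step: "x + zscale (coroot \<epsilon> x) (\<epsilon> - \<delta>) \<in> \<Phi>" if "x \<in> \<Phi>" for x
  proof -
    have "reflection coroot \<alpha> (reflection coroot \<beta> (reflection coroot \<alpha> x)) \<in> \<Phi>"
      using assms that by (intro refl_root)
    also have "reflection coroot \<alpha> (reflection coroot \<beta> (reflection coroot \<alpha> x)) =
        x - zscale (coroot \<epsilon> x) \<delta>"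
      unfolding reflection_def[of coroot \<beta>]
      using assms by (simp add: refl_diff refl_zscale refl_involution coroot_\<epsilon> \<delta>_def)
    finally have "reflection coroot \<epsilon> (x - zscale (coroot \<epsilon> x) \<delta>) \<in> \<Phi>"
      using \<epsilon> by (intro refl_root)
    then show ?thesis
      using \<epsilon> by (simp add: reflection_def \<epsilon>\<delta> zmod.scale_right_diff_distrib zmod.scale_minus_left algebra_simps)
  qed
  have "\<epsilon> + zscale (2 * int n) (\<epsilon> - \<delta>) \<in> \<Phi>" for n
  proof (induction n)
    case (Suc n)
    have "coroot \<epsilon> (\<epsilon> + zscale (2 * int n) (\<epsilon> - \<delta>)) = 2"
      using \<epsilon> by (simp add: coroot_add coroot_self \<epsilon>\<delta>)
    then show ?case
      using step[OF Suc] by (simp add: zscale_add_left add_ac)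
  qed (use \<epsilon> in simp)
  then have "range (\<lambda>n. \<epsilon> + zscale (2 * int n) (\<epsilon> - \<delta>)) \<subseteq> \<Phi>" by blast
  then have "finite (range (\<lambda>n. \<epsilon> + zscale (2 * int n) (\<epsilon> - \<delta>)))"
    using finite_roots by (rule finite_subset)
  then have "\<not> inj (\<lambda>n. \<epsilon> + zscale (2 * int n) (\<epsilon> - \<delta>))"
    using range_inj_infinite by blast
  then obtain m n where "m \<noteq> n" "\<epsilon> + zscale (2 * int m) (\<epsilon> - \<delta>) = \<epsilon> + zscale (2 * int n) (\<epsilon> - \<delta>)"
    unfolding inj_def by blast
  then have "zscale (2 * int m) (\<epsilon> - \<delta>) = zscale (2 * int n) (\<epsilon> - \<delta>)" by (simp only: add_left_cancel)
  then have "zscale (2 * int m - 2 * int n) (\<epsilon> - \<delta>) = 0"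
    by (simp only: zmod.scale_left_diff_distrib right_minus_eq)
  then have "\<epsilon> = \<delta>" using \<open>m \<noteq> n\<close> by simp
  then show ?thesis using coroot_\<epsilon> by (simp add: \<delta>_def)
qed

lemma refl_uminus_root: "\<alpha> \<in> \<Phi> \<Longrightarrow> reflection coroot (- \<alpha>) = reflection coroot \<alpha>"
proof -
  assume \<alpha>: "\<alpha> \<in> \<Phi>"
  have "coroot (- \<alpha>) \<mu> = - coroot \<alpha> \<mu>" for \<mu>
    using coroot_refl[OF \<alpha> \<alpha>, of \<mu>] \<alpha> by (simp add: refl_self) (simp add: reflection_def coroot_self)
  then show ?thesis
    by (simp add: reflection_def fun_eq_iff zmod.scale_minus_left)
qed

lemma weyl_add: "w \<in> weyl \<Phi> coroot \<Longrightarrow> w (\<mu> + \<nu>) = w \<mu> + w \<nu>"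
  by (induction rule: weyl.induct) (auto simp: refl_add)

lemma weyl_uminus: "w \<in> weyl \<Phi> coroot \<Longrightarrow> w (- \<mu>) = - w \<mu>"
  using weyl_add[of w 0 0] weyl_add[of w \<mu> "- \<mu>"] by (simp add: eq_neg_iff_add_eq_0 add.commute)

lemma weyl_root: "w \<in> weyl \<Phi> coroot \<Longrightarrow> \<alpha> \<in> \<Phi> \<Longrightarrow> w \<alpha> \<in> \<Phi>"
  by (induction rule: weyl.induct) (auto intro: refl_root)

lemma weyl_reflection: "\<alpha> \<in> \<Phi> \<Longrightarrow> reflection coroot \<alpha> \<in> weyl \<Phi> coroot"
  using weyl_refl[OF weyl_id] by simp

lemma weyl_comp: "w \<in> weyl \<Phi> coroot \<Longrightarrow> w' \<in> weyl \<Phi> coroot \<Longrightarrow> w \<circ> w' \<in> weyl \<Phi> coroot"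
  by (induction rule: weyl.induct) (auto simp: comp_assoc intro: weyl_refl)

lemma bij_reflection: "\<alpha> \<in> \<Phi> \<Longrightarrow> bij (reflection coroot \<alpha>)"
  by (rule o_bij[OF refl_comp_refl refl_comp_refl])

lemma weyl_bij: "w \<in> weyl \<Phi> coroot \<Longrightarrow> bij w"
proof (induction rule: weyl.induct)
  case weyl_id
  show "bij (id :: 'l \<Rightarrow> 'l)" by (rule bij_id)
next
  case (weyl_refl w \<alpha>)
  show "bij (reflection coroot \<alpha> \<circ> w)"
    using weyl_refl.IH bij_reflection[OF weyl_refl.hyps(2)] by (rule bij_comp)
qed

lemma weyl_inv: "w \<in> weyl \<Phi> coroot \<Longrightarrow> inv w \<in> weyl \<Phi> coroot"
proof (induction rule: weyl.induct)
  case (weyl_refl w \<alpha>)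
  have "inv (reflection coroot \<alpha>) = reflection coroot \<alpha>"
    using refl_comp_refl[OF weyl_refl(2)] refl_comp_refl[OF weyl_refl(2)] by (rule inv_unique_comp)
  then have "inv (reflection coroot \<alpha> \<circ> w) = inv w \<circ> reflection coroot \<alpha>"
    using weyl_refl by (subst o_inv_distrib) (auto intro: bij_reflection weyl_bij)
  then show "inv (reflection coroot \<alpha> \<circ> w) \<in> weyl \<Phi> coroot"
    using weyl_comp[OF weyl_refl.IH weyl_reflection[OF weyl_refl.hyps(2)]] by simp
next
  case weyl_id
  show "inv (id :: 'l \<Rightarrow> 'l) \<in> weyl \<Phi> coroot" by (simp add: weyl.weyl_id)
qed

lemma weyl_conj_reflection:
  assumes "w \<in> weyl \<Phi> coroot" "\<beta> \<in> \<Phi>"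
  shows "w \<circ> reflection coroot \<beta> = reflection coroot (w \<beta>) \<circ> w"
  using assms
proof (induction rule: weyl.induct)
  case (weyl_refl w \<alpha>)
  have conj: "reflection coroot \<alpha> \<circ> reflection coroot \<gamma> =
      reflection coroot (reflection coroot \<alpha> \<gamma>) \<circ> reflection coroot \<alpha>" if "\<gamma> \<in> \<Phi>" for \<gamma>
  proof
    fix \<mu>
    show "(reflection coroot \<alpha> \<circ> reflection coroot \<gamma>) \<mu> =
      (reflection coroot (reflection coroot \<alpha> \<gamma>) \<circ> reflection coroot \<alpha>) \<mu>"
      unfolding comp_apply reflection_def[of coroot \<gamma>] reflection_def[of coroot "reflection coroot \<alpha> \<gamma>"]
      using weyl_refl.hyps that by (simp add: refl_diff refl_zscale coroot_refl refl_involution)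
  qed
  have IH: "w \<circ> reflection coroot \<beta> = reflection coroot (w \<beta>) \<circ> w"
    using weyl_refl.IH[OF weyl_refl.prems] .
  have "(reflection coroot \<alpha> \<circ> w) \<circ> reflection coroot \<beta> = reflection coroot \<alpha> \<circ> reflection coroot (w \<beta>) \<circ> w"
    by (simp only: comp_assoc IH)
  also have "\<dots> = reflection coroot ((reflection coroot \<alpha> \<circ> w) \<beta>) \<circ> (reflection coroot \<alpha> \<circ> w)"
    using conj[OF weyl_root[OF weyl_refl.hyps(1) weyl_refl.prems]] by (simp only: comp_assoc[symmetric] comp_apply)
  finally show ?case .
qed auto

lemma nonproportional_roots:
  assumes "\<beta> \<in> \<Phi>" "\<gamma> \<in> \<Phi>" "\<gamma> \<noteq> \<beta>" "\<gamma> \<noteq> - \<beta>" "n \<noteq> 0"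
  shows "zscale n \<gamma> \<noteq> zscale m \<beta>"
  using reduced[of \<beta> \<gamma> n m] assms by metis

text \<open>
  A Weyl-invariant form, positive on roots and integral; it serves to find, for a positive root,
  a simple reflection that lowers its height.
\<close>

definition root_form :: "'l \<Rightarrow> 'l \<Rightarrow> int" where
  "root_form \<mu> \<nu> = (\<Sum>\<gamma>\<in>\<Phi>. coroot \<gamma> \<mu> * coroot \<gamma> \<nu>)"

lemma root_form_refl:
  assumes "\<alpha> \<in> \<Phi>"
  shows "root_form (reflection coroot \<alpha> \<mu>) (reflection coroot \<alpha> \<nu>) = root_form \<mu> \<nu>"
proof -
  have "bij_betw (reflection coroot \<alpha>) \<Phi> \<Phi>"
    using assms by (intro bij_betw_byWitness[where f' = "reflection coroot \<alpha>"])
      (auto simp: refl_involution refl_root)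
  then have "root_form \<mu> \<nu> =
      (\<Sum>\<gamma>\<in>\<Phi>. coroot (reflection coroot \<alpha> \<gamma>) \<mu> * coroot (reflection coroot \<alpha> \<gamma>) \<nu>)"
    unfolding root_form_def by (rule sum.reindex_bij_betw[symmetric])
  then show ?thesis using assms by (simp add: root_form_def coroot_refl)
qed

lemma root_form_pos: "\<alpha> \<in> \<Phi> \<Longrightarrow> root_form \<alpha> \<alpha> > 0"
  unfolding root_form_def using finite_roots
  by (intro sum_pos2[of _ \<alpha>]) (auto simp: coroot_self)

lemma root_form_uminus_right: "root_form \<mu> (- \<nu>) = - root_form \<mu> \<nu>"
  by (simp add: root_form_def sum_negf[symmetric])

lemma root_form_root:
  assumes "\<alpha> \<in> \<Phi>"
  shows "2 * root_form \<mu> \<alpha> = coroot \<alpha> \<mu> * root_form \<alpha> \<alpha>"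
proof -
  have lin: "root_form (x - zscale n y) z = root_form x z - n * root_form y z" for x y z n
    by (simp add: root_form_def sum_subtractf[symmetric] sum_distrib_left algebra_simps)
  have "root_form \<mu> \<alpha> = root_form (reflection coroot \<alpha> \<mu>) (- \<alpha>)"
    using root_form_refl[OF assms, of \<mu> \<alpha>] refl_self[OF assms] by simp
  then show ?thesis by (simp add: root_form_uminus_right reflection_def lin)
qed

lemma root_form_sum_right:
  "root_form \<mu> (\<Sum>i\<in>I. zscale (c i) (f i)) = (\<Sum>i\<in>I. c i * root_form \<mu> (f i))"
  by (simp add: root_form_def coroot_sum sum_distrib_left sum.swap[of _ _ I] mult_ac)

end

context based_root_datum
begin

abbreviation Pos :: "'l set" where "Pos \<equiv> pos_roots \<Phi> \<Delta>"

abbreviation refl :: "'l \<Rightarrow> 'l \<Rightarrow> 'l" where "refl \<equiv> reflection coroot"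

abbreviation W :: "('l \<Rightarrow> 'l) set" where "W \<equiv> weyl \<Phi> coroot"

abbreviation len :: "('l \<Rightarrow> 'l) \<Rightarrow> nat" where "len \<equiv> weyl_length coroot \<Delta>"

definition word :: "'l list \<Rightarrow> 'l \<Rightarrow> 'l" where
  "word \<alpha>s = foldr (\<lambda>\<alpha> x. refl \<alpha> \<circ> x) \<alpha>s id"

lemma finite_simple: "finite \<Delta>"
  using simple_subset finite_roots by (rule finite_subset)

lemma simple_root: "\<alpha> \<in> \<Delta> \<Longrightarrow> \<alpha> \<in> \<Phi>"
  using simple_subset by blast

lemma coeff_unique:
  assumes "(\<Sum>\<alpha>\<in>\<Delta>. zscale (c \<alpha>) \<alpha>) = (\<Sum>\<alpha>\<in>\<Delta>. zscale (d \<alpha>) \<alpha>)" "\<alpha> \<in> \<Delta>"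
  shows "c \<alpha> = d \<alpha>"
proof -
  have "(\<Sum>\<alpha>\<in>\<Delta>. zscale (c \<alpha> - d \<alpha>) \<alpha>) = 0"
    using assms(1) by (simp add: zmod.scale_left_diff_distrib sum_subtractf)
  then show ?thesis
    using zmod.independentD[OF simple_independent finite_simple subset_refl, of "\<lambda>\<alpha>. c \<alpha> - d \<alpha>"] assms(2)
    by simp
qed

lemma pos_root: "\<beta> \<in> Pos \<Longrightarrow> \<beta> \<in> \<Phi>"
  by (simp add: pos_roots_def)

lemma finite_pos: "finite Pos"
  using finite_roots by (rule finite_subset[rotated]) (auto simp: pos_roots_def)

lemma simple_sum: "\<alpha> \<in> \<Delta> \<Longrightarrow> zscale k \<alpha> = (\<Sum>\<gamma>\<in>\<Delta>. zscale (if \<gamma> = \<alpha> then k else 0) \<gamma>)"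
  using finite_simple by (simp add: if_distrib[of "\<lambda>k. zscale k _"] cong: if_cong)

lemma simple_pos: "\<alpha> \<in> \<Delta> \<Longrightarrow> \<alpha> \<in> Pos"
  using simple_sum[of \<alpha> 1] simple_root
  by (auto simp: pos_roots_def zscale_one intro!: exI[of _ "\<lambda>\<gamma>. if \<gamma> = \<alpha> then 1 else 0"])

lemma pos_or_neg: "\<beta> \<in> \<Phi> \<Longrightarrow> \<beta> \<in> Pos \<or> - \<beta> \<in> Pos"
proof -
  assume \<beta>: "\<beta> \<in> \<Phi>"
  then obtain c where c: "\<beta> = (\<Sum>\<alpha>\<in>\<Delta>. zscale (c \<alpha>) \<alpha>)" "(\<forall>\<alpha>\<in>\<Delta>. 0 \<le> c \<alpha>) \<or> (\<forall>\<alpha>\<in>\<Delta>. c \<alpha> \<le> 0)"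
    using root_simple_sum by blast
  then have "- \<beta> = (\<Sum>\<alpha>\<in>\<Delta>. zscale (- c \<alpha>) \<alpha>)"
    by (simp add: zmod.scale_minus_left sum_negf)
  then show ?thesis
    using c(2) c(1) \<beta> uminus_root[OF \<beta>] unfolding pos_roots_def
    by (elim disjE) (blast, (intro disjI2 CollectI conjI exI[of _ "\<lambda>\<alpha>. - c \<alpha>"], simp_all))
qed

lemma pos_not_neg: "\<beta> \<in> Pos \<Longrightarrow> - \<beta> \<notin> Pos"
proof
  assume "\<beta> \<in> Pos" "- \<beta> \<in> Pos"
  then obtain c d where c: "\<beta> = (\<Sum>\<alpha>\<in>\<Delta>. zscale (c \<alpha>) \<alpha>)" "\<forall>\<alpha>\<in>\<Delta>. 0 \<le> c \<alpha>"
    and d: "- \<beta> = (\<Sum>\<alpha>\<in>\<Delta>. zscale (d \<alpha>) \<alpha>)" "\<forall>\<alpha>\<in>\<Delta>. 0 \<le> d \<alpha>"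
    unfolding pos_roots_def by blast
  have "\<beta> = (\<Sum>\<alpha>\<in>\<Delta>. zscale (- d \<alpha>) \<alpha>)"
    using arg_cong[OF d(1), of uminus] by (simp add: zmod.scale_minus_left sum_negf)
  then have "c \<alpha> = - d \<alpha>" if "\<alpha> \<in> \<Delta>" for \<alpha>
    using coeff_unique[of c "\<lambda>\<alpha>. - d \<alpha>"] c(1) that by simp
  then have "c \<alpha> = 0" if "\<alpha> \<in> \<Delta>" for \<alpha>
    using c(2) d(2) that by force
  then have "\<beta> = 0" using c(1) by simp
  then show False using root_nonzero[OF pos_root[OF \<open>\<beta> \<in> Pos\<close>]] by simp
qed

text \<open>
  The simple reflection \<open>r\<^sub>\<alpha>\<close> changes only the coefficient of \<open>\<alpha>\<close>. A positive root that becomes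
  negative can have no other nonzero coefficient, so it is \<open>\<alpha>\<close>.
\<close>

lemma simple_reflection_pos:
  assumes \<alpha>: "\<alpha> \<in> \<Delta>" and \<beta>: "\<beta> \<in> Pos" and ne: "\<beta> \<noteq> \<alpha>"
  shows "refl \<alpha> \<beta> \<in> Pos"
proof (rule ccontr)
  assume notpos: "refl \<alpha> \<beta> \<notin> Pos"
  let ?k = "coroot \<alpha> \<beta>"
  obtain c where c: "\<beta> = (\<Sum>\<gamma>\<in>\<Delta>. zscale (c \<gamma>) \<gamma>)" "\<forall>\<gamma>\<in>\<Delta>. 0 \<le> c \<gamma>"
    using \<beta> unfolding pos_roots_def by blast
  have root: "refl \<alpha> \<beta> \<in> \<Phi>"
    using \<alpha> \<beta> by (intro refl_root simple_root pos_root)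
  obtain d where d: "refl \<alpha> \<beta> = (\<Sum>\<gamma>\<in>\<Delta>. zscale (d \<gamma>) \<gamma>)" "\<forall>\<gamma>\<in>\<Delta>. d \<gamma> \<le> 0"
    using root_simple_sum[OF root] notpos root unfolding pos_roots_def by blast
  have "refl \<alpha> \<beta> = (\<Sum>\<gamma>\<in>\<Delta>. zscale (c \<gamma> - (if \<gamma> = \<alpha> then ?k else 0)) \<gamma>)"
    by (simp add: reflection_def zmod.scale_left_diff_distrib sum_subtractf flip: c(1) simple_sum[OF \<alpha>])
  then have cd: "d \<gamma> = c \<gamma> - (if \<gamma> = \<alpha> then ?k else 0)" if "\<gamma> \<in> \<Delta>" for \<gamma>
    using coeff_unique[of d "\<lambda>\<gamma>. c \<gamma> - (if \<gamma> = \<alpha> then ?k else 0)"] d(1) that by simp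
  have "c \<gamma> = (if \<gamma> = \<alpha> then c \<alpha> else 0)" if "\<gamma> \<in> \<Delta>" for \<gamma>
    using cd[OF that] c(2)[rule_format, OF that] d(2)[rule_format, OF that] by (simp split: if_splits)
  then have "\<beta> = (\<Sum>\<gamma>\<in>\<Delta>. zscale (if \<gamma> = \<alpha> then c \<alpha> else 0) \<gamma>)"
    unfolding c(1) by (intro sum.cong) auto
  then have "zscale (c \<alpha>) \<alpha> = zscale 1 \<beta>"
    using simple_sum[OF \<alpha>] by (simp add: zscale_one)
  then have "\<beta> = - \<alpha>"
    using reduced[of \<alpha> \<beta> 1] simple_root[OF \<alpha>] pos_root[OF \<beta>] ne by auto
  then show False using pos_not_neg[OF simple_pos[OF \<alpha>]] \<beta> by simp
qed

text \<open>
  Otherwise the form of \<open>\<beta>\<close> with each simple root, hence with \<open>\<beta>\<close> itself, would be nonpositive.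
\<close>

lemma ex_simple_coroot_pos:
  assumes "\<beta> \<in> Pos"
  shows "\<exists>\<alpha>\<in>\<Delta>. coroot \<alpha> \<beta> > 0"
proof (rule ccontr)
  assume no: "\<not> ?thesis"
  obtain c where c: "\<beta> = (\<Sum>\<gamma>\<in>\<Delta>. zscale (c \<gamma>) \<gamma>)" "\<forall>\<gamma>\<in>\<Delta>. 0 \<le> c \<gamma>"
    using assms unfolding pos_roots_def by blast
  have "root_form \<beta> \<gamma> \<le> 0" if "\<gamma> \<in> \<Delta>" for \<gamma>
  proof -
    have "coroot \<gamma> \<beta> * root_form \<gamma> \<gamma> \<le> 0"
      using no that root_form_pos[OF simple_root[OF that]] by (intro mult_nonpos_nonneg) auto
    then show ?thesis using root_form_root[OF simple_root[OF that], of \<beta>] by linarith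
  qed
  then have "(\<Sum>\<gamma>\<in>\<Delta>. c \<gamma> * root_form \<beta> \<gamma>) \<le> 0"
    using c(2) by (intro sum_nonpos mult_nonneg_nonpos) auto
  then have "root_form \<beta> \<beta> \<le> 0"
    using root_form_sum_right[of \<beta> c "\<lambda>\<gamma>. \<gamma>" \<Delta>] c(1) by simp
  then show False using root_form_pos[OF pos_root[OF assms]] by simp
qed

lemma word_Nil [simp]: "word [] = id"
  by (simp add: word_def)

lemma word_Cons [simp]: "word (\<alpha> # xs) = refl \<alpha> \<circ> word xs"
  by (simp add: word_def)

lemma word_append: "word (xs @ ys) = word xs \<circ> word ys"
  by (induction xs) (simp_all add: comp_assoc)

lemma word_weyl: "set xs \<subseteq> \<Delta> \<Longrightarrow> word xs \<in> W"
  by (induction xs) (simp_all add: weyl_id weyl_refl simple_root)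

lemma word_rev: "set xs \<subseteq> \<Delta> \<Longrightarrow> word xs \<circ> word (rev xs) = id"
proof (induction xs)
  case (Cons a xs)
  have IH: "word xs \<circ> word (rev xs) = id"
    by (rule Cons.IH) (use Cons.prems in simp)
  have "word (a # xs) \<circ> word (rev (a # xs)) = refl a \<circ> (word xs \<circ> word (rev xs)) \<circ> refl a"
    by (simp add: word_append comp_assoc)
  also have "\<dots> = refl a \<circ> refl a" by (simp only: IH comp_id)
  also have "\<dots> = id" using Cons.prems by (simp add: refl_comp_refl simple_root)
  finally show ?case .
qed simp

text \<open>
  Induction on the height: unless \<open>\<beta>\<close> is simple, some simple reflection lowers the height and keeps
  the root positive. Consequently the simple reflections generate the Weyl group, without which
  \<open>weyl_length\<close> could be a minimum over an empty set.
\<close>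

lemma pos_conj_simple:
  "\<beta> \<in> \<Phi> \<Longrightarrow> \<beta> = (\<Sum>\<gamma>\<in>\<Delta>. zscale (c \<gamma>) \<gamma>) \<Longrightarrow> \<forall>\<gamma>\<in>\<Delta>. 0 \<le> c \<gamma> \<Longrightarrow>
    \<exists>xs \<alpha>. set xs \<subseteq> \<Delta> \<and> \<alpha> \<in> \<Delta> \<and> \<beta> = word xs \<alpha>"
proof (induction "nat (\<Sum>\<gamma>\<in>\<Delta>. c \<gamma>)" arbitrary: \<beta> c rule: less_induct)
  case less
  show ?case
  proof (cases "\<beta> \<in> \<Delta>")
    case True
    then show ?thesis by (intro exI[of _ "[]"] exI[of _ \<beta>]) simp
  next
    case False
    have \<beta>: "\<beta> \<in> Pos" using less.prems unfolding pos_roots_def by blast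
    obtain \<alpha> where \<alpha>: "\<alpha> \<in> \<Delta>" and k: "coroot \<alpha> \<beta> > 0"
      using ex_simple_coroot_pos[OF \<beta>] by blast
    have "refl \<alpha> \<beta> \<in> Pos" using simple_reflection_pos[OF \<alpha> \<beta>] False \<alpha> by blast
    then obtain d where root: "refl \<alpha> \<beta> \<in> \<Phi>"
      and d: "refl \<alpha> \<beta> = (\<Sum>\<gamma>\<in>\<Delta>. zscale (d \<gamma>) \<gamma>)" "\<forall>\<gamma>\<in>\<Delta>. 0 \<le> d \<gamma>"
      unfolding pos_roots_def by blast
    have "refl \<alpha> \<beta> = (\<Sum>\<gamma>\<in>\<Delta>. zscale (c \<gamma> - (if \<gamma> = \<alpha> then coroot \<alpha> \<beta> else 0)) \<gamma>)"
      by (simp add: reflection_def zmod.scale_left_diff_distrib sum_subtractf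
          flip: less.prems(2) simple_sum[OF \<alpha>])
    then have "d \<gamma> = c \<gamma> - (if \<gamma> = \<alpha> then coroot \<alpha> \<beta> else 0)" if "\<gamma> \<in> \<Delta>" for \<gamma>
      using coeff_unique[of d "\<lambda>\<gamma>. c \<gamma> - (if \<gamma> = \<alpha> then coroot \<alpha> \<beta> else 0)"] d(1) that by simp
    then have "(\<Sum>\<gamma>\<in>\<Delta>. d \<gamma>) = (\<Sum>\<gamma>\<in>\<Delta>. c \<gamma>) - coroot \<alpha> \<beta>"
      using finite_simple \<alpha> by (simp add: sum_subtractf)
    moreover have "(\<Sum>\<gamma>\<in>\<Delta>. d \<gamma>) \<ge> 0" using d(2) by (simp add: sum_nonneg)
    ultimately have "nat (\<Sum>\<gamma>\<in>\<Delta>. d \<gamma>) < nat (\<Sum>\<gamma>\<in>\<Delta>. c \<gamma>)" using k by linarith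
    then obtain xs \<delta> where xs: "set xs \<subseteq> \<Delta>" "\<delta> \<in> \<Delta>" "refl \<alpha> \<beta> = word xs \<delta>"
      using less.hyps[OF _ root d] by blast
    then have "\<beta> = word (\<alpha> # xs) \<delta>"
      using refl_involution[OF simple_root[OF \<alpha>], of \<beta>] by simp
    then show ?thesis using xs \<alpha> by (intro exI[of _ "\<alpha> # xs"] exI[of _ \<delta>]) simp
  qed
qed

lemma reflection_word:
  assumes "\<beta> \<in> \<Phi>"
  shows "\<exists>xs. set xs \<subseteq> \<Delta> \<and> refl \<beta> = word xs"
proof -
  have pos: "\<exists>xs. set xs \<subseteq> \<Delta> \<and> refl \<beta> = word xs" if "\<beta> \<in> Pos" for \<beta>
  proof -
    from that obtain c where c: "\<beta> = (\<Sum>\<gamma>\<in>\<Delta>. zscale (c \<gamma>) \<gamma>)" "\<forall>\<gamma>\<in>\<Delta>. 0 \<le> c \<gamma>"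
      unfolding pos_roots_def by blast
    obtain xs \<alpha> where xs: "set xs \<subseteq> \<Delta>" "\<alpha> \<in> \<Delta>" "\<beta> = word xs \<alpha>"
      using pos_conj_simple[OF pos_root[OF \<open>\<beta> \<in> Pos\<close>] c] by blast
    have "refl \<beta> = refl \<beta> \<circ> (word xs \<circ> word (rev xs))"
      using word_rev[OF xs(1)] by simp
    also have "\<dots> = word xs \<circ> refl \<alpha> \<circ> word (rev xs)"
      using weyl_conj_reflection[OF word_weyl[OF xs(1)] simple_root[OF xs(2)]] xs(3)
      by (simp add: comp_assoc[symmetric])
    also have "\<dots> = word (xs @ \<alpha> # rev xs)" by (simp add: word_append comp_assoc)
    finally show ?thesis using xs by (intro exI[of _ "xs @ \<alpha> # rev xs"]) simp
  qed
  show ?thesis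
    using pos_or_neg[OF assms] pos[of \<beta>] pos[of "- \<beta>"] refl_uminus_root[OF assms] by metis
qed

lemma weyl_word: "w \<in> W \<Longrightarrow> \<exists>xs. set xs \<subseteq> \<Delta> \<and> w = word xs"
proof (induction rule: weyl.induct)
  case weyl_id
  then show ?case by (intro exI[of _ "[]"]) simp
next
  case (weyl_refl w \<alpha>)
  then obtain xs ys where "set xs \<subseteq> \<Delta>" "w = word xs" "set ys \<subseteq> \<Delta>" "refl \<alpha> = word ys"
    using reflection_word by blast
  then have "refl \<alpha> \<circ> w = word (ys @ xs)" "set (ys @ xs) \<subseteq> \<Delta>" by (simp_all add: word_append)
  then show ?case by blast
qed

lemma len_word_le: "set xs \<subseteq> \<Delta> \<Longrightarrow> len (word xs) \<le> length xs"
  unfolding weyl_length_def word_def by (rule Least_le) blast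

lemma ex_reduced_word:
  assumes "w \<in> W"
  shows "\<exists>xs. set xs \<subseteq> \<Delta> \<and> length xs = len w \<and> w = word xs"
proof -
  have "\<exists>n xs. set xs \<subseteq> \<Delta> \<and> length xs = n \<and> w = word xs"
    using weyl_word[OF assms] by blast
  from LeastI_ex[OF this] show ?thesis unfolding weyl_length_def word_def .
qed

text \<open>
  Exchange condition: following \<open>\<beta>\<close> through the word from the right, it turns negative at some
  letter \<open>\<alpha>\<close>, where it equals \<open>\<alpha>\<close>; conjugating \<open>r\<^sub>\<beta>\<close> to that place cancels the letter.
\<close>

lemma word_exchange:
  "set xs \<subseteq> \<Delta> \<Longrightarrow> \<beta> \<in> Pos \<Longrightarrow> word xs \<beta> \<notin> Pos \<Longrightarrow>
    \<exists>ys. set ys \<subseteq> \<Delta> \<and> length ys < length xs \<and> word xs \<circ> refl \<beta> = word ys"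
proof (induction xs)
  case (Cons \<alpha> xs)
  then have \<alpha>: "\<alpha> \<in> \<Delta>" and xs: "set xs \<subseteq> \<Delta>" by auto
  show ?case
  proof (cases "word xs \<beta> \<in> Pos")
    case True
    then have eq: "word xs \<beta> = \<alpha>"
      using simple_reflection_pos[OF \<alpha> True] Cons.prems(3) by (auto simp: comp_def)
    have "word (\<alpha> # xs) \<circ> refl \<beta> = refl \<alpha> \<circ> (refl \<alpha> \<circ> word xs)"
      using weyl_conj_reflection[OF word_weyl[OF xs] pos_root[OF Cons.prems(2)]] eq
      by (simp add: comp_assoc)
    also have "\<dots> = word xs"
      using refl_comp_refl[OF simple_root[OF \<alpha>]] by (simp add: comp_assoc[symmetric])
    finally have "word (\<alpha> # xs) \<circ> refl \<beta> = word xs" .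
    moreover have "length xs < length (\<alpha> # xs)" by simp
    ultimately show ?thesis using xs by blast
  next
    case False
    then obtain ys where "set ys \<subseteq> \<Delta>" "length ys < length xs" "word xs \<circ> refl \<beta> = word ys"
      using Cons.IH[OF xs Cons.prems(2)] by blast
    then have "word (\<alpha> # xs) \<circ> refl \<beta> = word (\<alpha> # ys)" "set (\<alpha> # ys) \<subseteq> \<Delta>"
      "length (\<alpha> # ys) < length (\<alpha> # xs)"
      using \<alpha> by (simp_all add: comp_assoc)
    then show ?thesis by blast
  qed
qed simp

lemma len_comp_reflection_less:
  assumes "v \<in> W" "\<beta> \<in> Pos" "v \<beta> \<notin> Pos"
  shows "len (v \<circ> refl \<beta>) < len v"
proof -
  obtain xs where xs: "set xs \<subseteq> \<Delta>" "length xs = len v" "v = word xs"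
    using ex_reduced_word[OF assms(1)] by blast
  then obtain ys where "set ys \<subseteq> \<Delta>" "length ys < length xs" "word xs \<circ> refl \<beta> = word ys"
    using word_exchange[of xs \<beta>] assms by blast
  then show ?thesis using len_word_le[of ys] xs by simp
qed

lemma bruhat_less_len: "bruhat_less \<Phi> coroot \<Delta> u v \<Longrightarrow> len u < len v"
proof -
  have "bruhat_le \<Phi> coroot \<Delta> u v \<Longrightarrow> u = v \<or> len u < len v"
    unfolding bruhat_le_def by (induction rule: rtranclp_induct) (auto simp: bruhat_step_def)
  then show "bruhat_less \<Phi> coroot \<Delta> u v \<Longrightarrow> len u < len v"
    by (auto simp: bruhat_less_def)
qed

lemma bruhat_less_comp_reflection:
  assumes "v \<in> W" "\<beta> \<in> Pos" "v \<beta> \<notin> Pos"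
  shows "bruhat_less \<Phi> coroot \<Delta> (v \<circ> refl \<beta>) v"
proof -
  have \<beta>: "\<beta> \<in> \<Phi>" using assms(2) by (rule pos_root)
  have "v \<circ> refl \<beta> \<circ> refl \<beta> = v" using refl_comp_refl[OF \<beta>] by (simp add: comp_assoc)
  then have "bruhat_step \<Phi> coroot \<Delta> (v \<circ> refl \<beta>) v"
    unfolding bruhat_step_def
    using len_comp_reflection_less[OF assms] weyl_comp[OF assms(1) weyl_reflection[OF \<beta>]] \<beta>
    by (intro conjI bexI[of _ \<beta>]) auto
  then show ?thesis
    unfolding bruhat_less_def bruhat_le_def
    using len_comp_reflection_less[OF assms] by (metis less_irrefl r_into_rtranclp)
qed

lemma simple_comp:
  assumes "v \<in> W" "\<alpha> \<in> \<Delta>"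
  shows "refl \<alpha> \<circ> v = v \<circ> refl (inv v \<alpha>)"
  using weyl_conj_reflection[OF assms(1) weyl_root[OF weyl_inv[OF assms(1)] simple_root[OF assms(2)]]]
    weyl_bij[OF assms(1)] by (simp add: bij_is_surj surj_f_inv_f)

lemma inv_simple_root: "v \<in> W \<Longrightarrow> \<alpha> \<in> \<Delta> \<Longrightarrow> inv v \<alpha> \<in> \<Phi>"
  using weyl_root[OF weyl_inv] simple_root by blast

lemma left_descent:
  assumes v: "v \<in> W" and \<alpha>: "\<alpha> \<in> \<Delta>" and neg: "- inv v \<alpha> \<in> Pos"
  shows "bruhat_less \<Phi> coroot \<Delta> (refl \<alpha> \<circ> v) v"
proof -
  have "v (- inv v \<alpha>) = - \<alpha>"
    using weyl_bij[OF v] by (simp add: weyl_uminus[OF v] bij_is_surj surj_f_inv_f)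
  then have "bruhat_less \<Phi> coroot \<Delta> (v \<circ> refl (- inv v \<alpha>)) v"
    using bruhat_less_comp_reflection[OF v neg] pos_not_neg[OF simple_pos[OF \<alpha>]] by simp
  moreover have "refl (- inv v \<alpha>) = refl (inv v \<alpha>)"
    using inv_simple_root[OF v \<alpha>] by (rule refl_uminus_root)
  ultimately show ?thesis using simple_comp[OF v \<alpha>] by simp
qed

lemma inv_simple_comp:
  assumes v: "v \<in> W" and \<alpha>: "\<alpha> \<in> \<Delta>"
  shows "inv (refl \<alpha> \<circ> v) \<alpha> = - inv v \<alpha>"
proof -
  have "(refl \<alpha> \<circ> v) (- inv v \<alpha>) = \<alpha>"
    using weyl_bij[OF v] refl_involution[OF simple_root[OF \<alpha>], of \<alpha>] refl_self[OF simple_root[OF \<alpha>]]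
    by (simp add: weyl_uminus[OF v] bij_is_surj surj_f_inv_f)
  moreover have "bij (refl \<alpha> \<circ> v)"
    using weyl_bij[OF weyl_refl[OF v simple_root[OF \<alpha>]]] .
  ultimately show ?thesis by (metis bij_inv_eq_iff)
qed

lemma left_ascent:
  assumes v: "v \<in> W" and \<alpha>: "\<alpha> \<in> \<Delta>" and pos: "inv v \<alpha> \<in> Pos"
  shows "bruhat_less \<Phi> coroot \<Delta> v (refl \<alpha> \<circ> v)"
proof -
  have "refl \<alpha> \<circ> (refl \<alpha> \<circ> v) = v"
    using refl_comp_refl[OF simple_root[OF \<alpha>]] by (simp add: comp_assoc[symmetric])
  then show ?thesis
    using left_descent[OF weyl_refl[OF v simple_root[OF \<alpha>]] \<alpha>] inv_simple_comp[OF v \<alpha>] pos by simp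
qed

lemma ex_left_descent:
  assumes v: "v \<in> W" "v \<noteq> id"
  shows "\<exists>\<alpha>\<in>\<Delta>. - inv v \<alpha> \<in> Pos"
proof -
  obtain xs where xs: "set xs \<subseteq> \<Delta>" "length xs = len v" "v = word xs"
    using ex_reduced_word[OF v(1)] by blast
  with v(2) obtain \<alpha> ys where ys: "xs = \<alpha> # ys" by (cases xs) auto
  then have \<alpha>: "\<alpha> \<in> \<Delta>" using xs by simp
  have "refl \<alpha> \<circ> v = word ys"
    using refl_comp_refl[OF simple_root[OF \<alpha>]] xs ys by (simp add: comp_assoc[symmetric])
  then have "len (refl \<alpha> \<circ> v) < len v" using len_word_le[of ys] xs ys by simp
  then have "inv v \<alpha> \<notin> Pos"
    using bruhat_less_len[OF left_ascent[OF v(1) \<alpha>]] by auto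
  moreover have "inv v \<alpha> \<in> \<Phi>" using inv_simple_root[OF v(1) \<alpha>] .
  ultimately show ?thesis using \<alpha> pos_or_neg by blast
qed

lemma bruhat_le_id: "bruhat_le \<Phi> coroot \<Delta> u id \<Longrightarrow> u = id"
  using bruhat_less_len[of u id] len_word_le[of "[]"] by (auto simp: bruhat_less_def)

end

section \<open>Rational functions without a pole along a subtorus\<close>

text \<open>
  Fractions whose denominator is not a zero divisor on the subgroup \<open>y\<^sup>\<beta> = 1\<close>, i.e. vanishes on
  none of its components: the functions regular at the generic points of \<open>y\<^sup>\<beta> = 1\<close>.
\<close>

definition regular_along :: "'l::lattice_group \<Rightarrow> 'l torus_ring fract set" where
  "regular_along \<beta> =
     {to_fract a / to_fract b | a b. b \<noteq> 0 \<and> (\<forall>g. 1 - ychar \<beta> dvd b * g \<longrightarrow> 1 - ychar \<beta> dvd g)}"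

lemma regular_alongI:
  assumes "b \<noteq> 0" "\<And>g. 1 - ychar \<beta> dvd b * g \<Longrightarrow> 1 - ychar \<beta> dvd g"
  shows "to_fract a / to_fract b \<in> regular_along \<beta>"
  using assms unfolding regular_along_def by blast

lemma regular_alongE:
  assumes "x \<in> regular_along \<beta>"
  obtains a b where "x = to_fract a / to_fract b" "b \<noteq> 0"
    "\<And>g. 1 - ychar \<beta> dvd b * g \<Longrightarrow> 1 - ychar \<beta> dvd g"
  using assms unfolding regular_along_def by blast

lemma regular_to_fract [simp]: "to_fract a \<in> regular_along \<beta>"
  using regular_alongI[of 1 \<beta> a] by simp

lemma regular_0 [simp]: "0 \<in> regular_along \<beta>"
  using regular_to_fract[of 0 \<beta>] by simp

lemma regular_1 [simp]: "1 \<in> regular_along \<beta>"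
  using regular_to_fract[of 1 \<beta>] by simp

lemma regular_mult:
  assumes "x \<in> regular_along \<beta>" "y \<in> regular_along \<beta>"
  shows "x * y \<in> regular_along \<beta>"
proof -
  obtain a b where x: "x = to_fract a / to_fract b" "b \<noteq> 0"
    and b: "\<And>g. 1 - ychar \<beta> dvd b * g \<Longrightarrow> 1 - ychar \<beta> dvd g"
    using assms(1) by (rule regular_alongE) blast
  obtain c d where y: "y = to_fract c / to_fract d" "d \<noteq> 0"
    and d: "\<And>g. 1 - ychar \<beta> dvd d * g \<Longrightarrow> 1 - ychar \<beta> dvd g"
    using assms(2) by (rule regular_alongE) blast
  have "1 - ychar \<beta> dvd g" if "1 - ychar \<beta> dvd (b * d) * g" for g
    by (rule d, rule b) (use that in \<open>simp only: mult.assoc\<close>)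
  moreover have "b * d \<noteq> 0" using x(2) y(2) by simp
  ultimately have "to_fract (a * c) / to_fract (b * d) \<in> regular_along \<beta>"
    by (intro regular_alongI)
  then show ?thesis using x y by simp
qed

lemma regular_add:
  assumes "x \<in> regular_along \<beta>" "y \<in> regular_along \<beta>"
  shows "x + y \<in> regular_along \<beta>"
proof -
  obtain a b where x: "x = to_fract a / to_fract b" "b \<noteq> 0"
    and b: "\<And>g. 1 - ychar \<beta> dvd b * g \<Longrightarrow> 1 - ychar \<beta> dvd g"
    using assms(1) by (rule regular_alongE) blast
  obtain c d where y: "y = to_fract c / to_fract d" "d \<noteq> 0"
    and d: "\<And>g. 1 - ychar \<beta> dvd d * g \<Longrightarrow> 1 - ychar \<beta> dvd g"
    using assms(2) by (rule regular_alongE) blast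
  have "1 - ychar \<beta> dvd g" if "1 - ychar \<beta> dvd (b * d) * g" for g
    by (rule d, rule b) (use that in \<open>simp only: mult.assoc\<close>)
  moreover have "b * d \<noteq> 0" using x(2) y(2) by simp
  ultimately have "to_fract (a * d + c * b) / to_fract (b * d) \<in> regular_along \<beta>"
    by (intro regular_alongI)
  then show ?thesis using x y by (simp add: add_frac_eq)
qed

lemma regular_uminus: "x \<in> regular_along \<beta> \<Longrightarrow> - x \<in> regular_along \<beta>"
  using regular_mult[OF regular_to_fract[of "- 1" \<beta>]] by fastforce

lemma regular_diff: "x \<in> regular_along \<beta> \<Longrightarrow> y \<in> regular_along \<beta> \<Longrightarrow> x - y \<in> regular_along \<beta>"
  using regular_add[of x \<beta> "- y"] regular_uminus[of y \<beta>] by simp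

lemma regular_prod:
  "(\<And>i. i \<in> I \<Longrightarrow> f i \<in> regular_along \<beta>) \<Longrightarrow> (\<Prod>i\<in>I. f i) \<in> regular_along \<beta>"
  by (induction I rule: infinite_finite_induct) (auto intro: regular_mult)

lemmas regular_intros = regular_mult regular_add regular_diff regular_uminus

text \<open>
  Equality of restrictions to \<open>y\<^sup>\<beta> = 1\<close>, when both sides are regular there.
\<close>

definition cong_along ::
  "'l::lattice_group \<Rightarrow> 'l torus_ring fract \<Rightarrow> 'l torus_ring fract \<Rightarrow> bool" where
  "cong_along \<beta> x y \<longleftrightarrow> (\<exists>z\<in>regular_along \<beta>. x - y = (1 - to_fract (ychar \<beta>)) * z)"

lemma cong_trans: "cong_along \<beta> x y \<Longrightarrow> cong_along \<beta> y z \<Longrightarrow> cong_along \<beta> x z"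
  unfolding cong_along_def
proof (elim bexE)
  fix a b assume "a \<in> regular_along \<beta>" "b \<in> regular_along \<beta>"
    "x - y = (1 - to_fract (ychar \<beta>)) * a" "y - z = (1 - to_fract (ychar \<beta>)) * b"
  moreover have "x - z = (x - y) + (y - z)" by simp
  ultimately show "\<exists>c\<in>regular_along \<beta>. x - z = (1 - to_fract (ychar \<beta>)) * c"
    by (intro bexI[of _ "a + b"] regular_add) (simp_all only: distrib_left)
qed

lemma cong_add:
  "cong_along \<beta> x y \<Longrightarrow> cong_along \<beta> x' y' \<Longrightarrow> cong_along \<beta> (x + x') (y + y')"
  unfolding cong_along_def
proof (elim bexE)
  fix a b assume "a \<in> regular_along \<beta>" "b \<in> regular_along \<beta>"
    "x - y = (1 - to_fract (ychar \<beta>)) * a" "x' - y' = (1 - to_fract (ychar \<beta>)) * b"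
  then show "\<exists>c\<in>regular_along \<beta>. x + x' - (y + y') = (1 - to_fract (ychar \<beta>)) * c"
    by (intro bexI[of _ "a + b"] regular_add) (auto simp: algebra_simps)
qed

lemma cong_mult_left:
  "c \<in> regular_along \<beta> \<Longrightarrow> cong_along \<beta> x y \<Longrightarrow> cong_along \<beta> (c * x) (c * y)"
  unfolding cong_along_def
proof (elim bexE)
  fix a assume "c \<in> regular_along \<beta>" "a \<in> regular_along \<beta>" "x - y = (1 - to_fract (ychar \<beta>)) * a"
  then show "\<exists>z\<in>regular_along \<beta>. c * x - c * y = (1 - to_fract (ychar \<beta>)) * z"
    by (intro bexI[of _ "c * a"] regular_mult) (auto simp: right_diff_distrib[symmetric])
qed

lemma cong_ychar_shift:
  "cong_along \<beta> (to_fract (ychar (\<mu> + zscale m \<beta>))) (to_fract (ychar \<mu>))"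
proof -
  obtain h where "ychar (\<mu> + zscale m \<beta>) - ychar \<mu> = (1 - ychar \<beta>) * h"
    using one_minus_ychar_dvd_shift by (rule dvdE)
  from arg_cong[OF this, of to_fract] show ?thesis
    unfolding cong_along_def by (intro bexI[of _ "to_fract h"]) auto
qed

text \<open>
  Reduces the theorem to one root at a time: a denominator factor \<open>1 - y\<^sup>\<beta>\<close> divides the numerator
  as soon as the function is regular along \<open>y\<^sup>\<beta> = 1\<close>, and can be cancelled.
\<close>

lemma regular_everywhere:
  assumes P: "finite P" "0 \<notin> P"
    and x: "x = to_fract f / to_fract (\<Prod>\<alpha>\<in>P. (1 - ychar \<alpha>) ^ k \<alpha>)"
    and reg: "\<And>\<beta>. \<beta> \<in> P \<Longrightarrow> x \<in> regular_along \<beta>"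
  shows "x \<in> range to_fract"
  using x
proof (induction "\<Sum>\<alpha>\<in>P. k \<alpha>" arbitrary: f k rule: less_induct)
  case less
  let ?D = "\<lambda>k. \<Prod>\<alpha>\<in>P. (1 - ychar \<alpha>) ^ k \<alpha>"
  have nz: "1 - ychar \<alpha> \<noteq> 0" if "\<alpha> \<in> P" for \<alpha>
    using that P(2) ychar_eq_1_iff[of \<alpha>] by auto
  have Dnz: "?D k \<noteq> 0" for k
    using P(1) nz by simp
  show ?case
  proof (cases "\<forall>\<alpha>\<in>P. k \<alpha> = 0")
    case True
    then show ?thesis using less.prems by simp
  next
    case False
    then obtain \<beta> where \<beta>: "\<beta> \<in> P" "k \<beta> > 0" by auto
    define k' where "k' = k(\<beta> := k \<beta> - 1)"
    have "k \<beta> = Suc (k' \<beta>)" using \<beta> by (simp add: k'_def)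
    moreover have "(\<Prod>\<alpha>\<in>P - {\<beta>}. (1 - ychar \<alpha>) ^ k \<alpha>) = (\<Prod>\<alpha>\<in>P - {\<beta>}. (1 - ychar \<alpha>) ^ k' \<alpha>)"
      by (intro prod.cong) (auto simp: k'_def)
    ultimately have D: "?D k = (1 - ychar \<beta>) * ?D k'"
      using P(1) \<beta>(1) by (simp add: prod.remove mult.assoc)
    obtain a b where ab: "x = to_fract a / to_fract b" "b \<noteq> 0"
      and b: "\<And>g. 1 - ychar \<beta> dvd b * g \<Longrightarrow> 1 - ychar \<beta> dvd g"
      using reg[OF \<beta>(1)] by (rule regular_alongE) blast
    have "to_fract (b * f) = to_fract (a * ?D k)"
      using ab less.prems Dnz[of k] unfolding to_fract_mult
      by (simp only: frac_eq_eq to_fract_eq_0_iff not_False_eq_True mult.commute)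
    then have "b * f = a * ((1 - ychar \<beta>) * ?D k')"
      unfolding to_fract_eq_iff D .
    then have "b * f = (1 - ychar \<beta>) * (a * ?D k')" by (simp only: ac_simps)
    then have "1 - ychar \<beta> dvd f" by (rule b[OF dvdI])
    then obtain f' where f': "f = (1 - ychar \<beta>) * f'" by (rule dvdE)
    have "x = to_fract f' / to_fract (?D k')"
      unfolding less.prems f' D to_fract_mult
      using nz[OF \<beta>(1)] by (intro mult_divide_mult_cancel_left) (simp only: to_fract_eq_0_iff not_False_eq_True)
    moreover have "(\<Sum>\<alpha>\<in>P. k' \<alpha>) < (\<Sum>\<alpha>\<in>P. k \<alpha>)"
      using P(1) \<beta> by (intro sum_strict_mono_ex1) (auto simp: k'_def)
    ultimately show ?thesis using less.hyps by blast
  qed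
qed

section \<open>Residues of the deformed R-polynomials\<close>

locale deformed_R = based_root_datum \<Phi> coroot \<Delta>
  for \<Phi> :: "'l::lattice_group set" and coroot :: "'l \<Rightarrow> 'l \<Rightarrow> int" and \<Delta> :: "'l set" +
  fixes r :: "('l \<Rightarrow> 'l) \<Rightarrow> ('l \<Rightarrow> 'l) \<Rightarrow> 'l torus_ring fract"
  assumes deformed_R: "is_deformed_R \<Phi> coroot \<Delta> r"
begin

abbreviation Y :: "'l \<Rightarrow> 'l torus_ring fract" where "Y \<mu> \<equiv> to_fract (ychar \<mu>)"

abbreviation Q :: "'l torus_ring fract" where "Q \<equiv> to_fract qvar"

text \<open>
  The right-hand side of the recursion, as an operator on the functions of \<open>u\<close>. Reading \<open>f\<close> as the
  element \<open>\<Sum>\<^sub>u f(u) T\<^sub>u\<close> of a Hecke algebra with \<open>T\<^sub>\<alpha>\<^sup>2 = (1 - q) T\<^sub>\<alpha> + q\<close>, it is left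
  multiplication by \<open>T\<^sub>\<alpha> + (1 - q) y / (1 - y)\<close>.
\<close>

definition intertwiner ::
  "'l \<Rightarrow> 'l torus_ring fract \<Rightarrow> (('l \<Rightarrow> 'l) \<Rightarrow> 'l torus_ring fract) \<Rightarrow> ('l \<Rightarrow> 'l) \<Rightarrow> 'l torus_ring fract"
where
  "intertwiner \<alpha> y f u =
     (if len (refl \<alpha> \<circ> u) < len u
      then (1 - Q) / (1 - y) * f u + f (refl \<alpha> \<circ> u)
      else (1 - Q) * (y / (1 - y)) * f u + Q * f (refl \<alpha> \<circ> u))"

lemma Y_minus: "Y \<mu> * Y (- \<mu>) = 1"
proof -
  have "ychar \<mu> * ychar (- \<mu>) = 1" by (simp flip: ychar_add)
  from arg_cong[OF this, of to_fract] show ?thesis by simp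
qed

lemma Y_eq_1_iff: "Y \<mu> = 1 \<longleftrightarrow> \<mu> = 0"
  using to_fract_eq_iff[of "ychar \<mu>" 1] by simp

lemma Y_root_ne_1: "\<alpha> \<in> \<Phi> \<Longrightarrow> 1 - Y \<alpha> \<noteq> 0"
  using Y_eq_1_iff root_nonzero by simp

lemma ascent_or_descent:
  assumes "u \<in> W" "\<alpha> \<in> \<Delta>"
  shows "bruhat_less \<Phi> coroot \<Delta> (refl \<alpha> \<circ> u) u \<or> bruhat_less \<Phi> coroot \<Delta> u (refl \<alpha> \<circ> u)"
  using pos_or_neg[OF inv_simple_root[OF assms]] left_ascent[OF assms] left_descent[OF assms] by blast

lemma simple_comp_weyl: "u \<in> W \<Longrightarrow> \<alpha> \<in> \<Delta> \<Longrightarrow> refl \<alpha> \<circ> u \<in> W"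
  by (rule weyl_refl[OF _ simple_root])

lemma simple_comp_twice: "\<alpha> \<in> \<Delta> \<Longrightarrow> refl \<alpha> \<circ> (refl \<alpha> \<circ> u) = u"
  using refl_comp_refl[OF simple_root] by (simp add: comp_assoc[symmetric])

lemma r_recursion:
  assumes "u \<in> W" "v \<in> W" "\<alpha> \<in> \<Delta>" "- inv v \<alpha> \<in> Pos"
  shows "r u v = intertwiner \<alpha> (Y (- inv v \<alpha>)) (\<lambda>u. r u (refl \<alpha> \<circ> v)) u"
proof -
  have "bruhat_less \<Phi> coroot \<Delta> (refl \<alpha> \<circ> v) v" using assms by (intro left_descent)
  then have rec:
    "bruhat_less \<Phi> coroot \<Delta> (refl \<alpha> \<circ> u) u \<Longrightarrow>
      r u v = (1 - Q) / (1 - Y (- inv v \<alpha>)) * r u (refl \<alpha> \<circ> v) + r (refl \<alpha> \<circ> u) (refl \<alpha> \<circ> v)"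
    "bruhat_less \<Phi> coroot \<Delta> u (refl \<alpha> \<circ> u) \<Longrightarrow>
      r u v = (1 - Q) * (Y (- inv v \<alpha>) / (1 - Y (- inv v \<alpha>))) * r u (refl \<alpha> \<circ> v) +
        Q * r (refl \<alpha> \<circ> u) (refl \<alpha> \<circ> v)"
    using deformed_R assms unfolding is_deformed_R_def Let_def by blast+
  show ?thesis
    using ascent_or_descent[OF assms(1,3)]
  proof
    assume less: "bruhat_less \<Phi> coroot \<Delta> (refl \<alpha> \<circ> u) u"
    show ?thesis unfolding intertwiner_def rec(1)[OF less] using bruhat_less_len[OF less] by simp
  next
    assume less: "bruhat_less \<Phi> coroot \<Delta> u (refl \<alpha> \<circ> u)"
    show ?thesis unfolding intertwiner_def rec(2)[OF less] using bruhat_less_len[OF less] by simp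
  qed
qed

lemma r_support: "u \<in> W \<Longrightarrow> v \<in> W \<Longrightarrow> \<not> bruhat_le \<Phi> coroot \<Delta> u v \<Longrightarrow> r u v = 0"
  using deformed_R unfolding is_deformed_R_def by blast

lemma r_id_regular:
  assumes "u \<in> W"
  shows "r u id \<in> regular_along \<beta>"
proof (cases "u = id")
  case True
  have "r id id = 1" using deformed_R weyl_id unfolding is_deformed_R_def by blast
  then show ?thesis using True by simp
next
  case False
  then have "r u id = 0" using r_support[OF assms weyl_id] bruhat_le_id by blast
  then show ?thesis by simp
qed

lemma intertwiner_ext: "f u = g u \<Longrightarrow> f (refl \<alpha> \<circ> u) = g (refl \<alpha> \<circ> u) \<Longrightarrow> intertwiner \<alpha> y f u = intertwiner \<alpha> y g u"
  by (simp add: intertwiner_def)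

lemma intertwiner_scale: "intertwiner \<alpha> y (\<lambda>u. c * f u) u = c * intertwiner \<alpha> y f u"
  by (simp add: intertwiner_def algebra_simps)

text \<open>
  In the Hecke algebra: for \<open>c = (1 - q) y / (1 - y)\<close> and \<open>c'\<close> its value at \<open>1 / y\<close> one has
  \<open>c + c' = q - 1\<close>, so that \<open>(T\<^sub>\<alpha> + c) (T\<^sub>\<alpha> + c') = q + c c'\<close> is a scalar.
\<close>

lemma intertwiner_opposite:
  assumes u: "u \<in> W" and \<alpha>: "\<alpha> \<in> \<Delta>" and y: "y * y' = 1" "1 - y \<noteq> 0"
  shows "intertwiner \<alpha> y (intertwiner \<alpha> y' f) u = (Q - (1 - Q) * (1 - Q) * y * (1 / (1 - y)) * (1 / (1 - y))) * f u"
proof -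
  have "y \<noteq> 0" using y by auto
  then have y': "y' = 1 / y" using y by (simp add: field_simps)
  then have "1 - y' \<noteq> 0" using y \<open>y \<noteq> 0\<close> by auto
  show ?thesis
    using ascent_or_descent[OF u \<alpha>]
  proof
    assume "bruhat_less \<Phi> coroot \<Delta> (refl \<alpha> \<circ> u) u"
    from bruhat_less_len[OF this] show ?thesis
      using y \<open>y \<noteq> 0\<close> \<open>1 - y' \<noteq> 0\<close> unfolding y'
      by (simp add: intertwiner_def simple_comp_twice[OF \<alpha>] divide_simps) algebra
  next
    assume "bruhat_less \<Phi> coroot \<Delta> u (refl \<alpha> \<circ> u)"
    from bruhat_less_len[OF this] show ?thesis
      using y \<open>y \<noteq> 0\<close> \<open>1 - y' \<noteq> 0\<close> unfolding y'
      by (simp add: intertwiner_def simple_comp_twice[OF \<alpha>] divide_simps) algebra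
  qed
qed

lemma inverse_regular:
  assumes "\<beta> \<in> \<Phi>" "\<gamma> \<in> \<Phi>" "\<gamma> \<noteq> \<beta>" "\<gamma> \<noteq> - \<beta>"
  shows "1 / (1 - Y \<gamma>) \<in> regular_along \<beta>"
proof -
  have "1 - ychar \<gamma> \<noteq> 0" using root_nonzero[OF assms(2)] ychar_eq_1_iff[of \<gamma>] by auto
  then have "to_fract 1 / to_fract (1 - ychar \<gamma>) \<in> regular_along \<beta>"
    using one_minus_ychar_cancel[OF nonproportional_roots[OF assms]] by (intro regular_alongI)
  then show ?thesis by simp
qed

lemma intertwiner_coeff_regular:
  assumes "\<beta> \<in> \<Phi>" "\<gamma> \<in> \<Phi>" "\<gamma> \<noteq> \<beta>" "\<gamma> \<noteq> - \<beta>"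
  shows "(1 - Q) / (1 - Y \<gamma>) \<in> regular_along \<beta>" "(1 - Q) * (Y \<gamma> / (1 - Y \<gamma>)) \<in> regular_along \<beta>"
proof -
  have "(1 - Q) * (1 / (1 - Y \<gamma>)) \<in> regular_along \<beta>" "(1 - Q) * (Y \<gamma> * (1 / (1 - Y \<gamma>))) \<in> regular_along \<beta>"
    using inverse_regular[OF assms]
    by (intro regular_mult regular_diff regular_1 regular_to_fract; assumption)+
  then show "(1 - Q) / (1 - Y \<gamma>) \<in> regular_along \<beta>" "(1 - Q) * (Y \<gamma> / (1 - Y \<gamma>)) \<in> regular_along \<beta>"
    by simp_all
qed

lemma intertwiner_regular:
  assumes "\<beta> \<in> \<Phi>" "\<gamma> \<in> \<Phi>" "\<gamma> \<noteq> \<beta>" "\<gamma> \<noteq> - \<beta>"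
    and "f u \<in> regular_along \<beta>" "f (refl \<alpha> \<circ> u) \<in> regular_along \<beta>"
  shows "intertwiner \<alpha> (Y \<gamma>) f u \<in> regular_along \<beta>"
proof -
  have coeff: "(1 - Q) / (1 - Y \<gamma>) \<in> regular_along \<beta>" "(1 - Q) * (Y \<gamma> / (1 - Y \<gamma>)) \<in> regular_along \<beta>"
    using intertwiner_coeff_regular[OF assms(1-4)] by blast+
  show ?thesis
    using regular_add[OF regular_mult[OF coeff(1) assms(5)] assms(6)]
      regular_add[OF regular_mult[OF coeff(2) assms(5)] regular_mult[OF regular_to_fract assms(6), of qvar]]
    unfolding intertwiner_def by (cases "len (refl \<alpha> \<circ> u) < len u") (simp_all only: if_True if_False)
qed

lemma intertwiner_cong:
  assumes "\<beta> \<in> \<Phi>" "\<gamma> \<in> \<Phi>" "\<gamma> \<noteq> \<beta>" "\<gamma> \<noteq> - \<beta>"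
    and "cong_along \<beta> (f u) (g u)" "cong_along \<beta> (f (refl \<alpha> \<circ> u)) (g (refl \<alpha> \<circ> u))"
  shows "cong_along \<beta> (intertwiner \<alpha> (Y \<gamma>) f u) (intertwiner \<alpha> (Y \<gamma>) g u)"
proof -
  note reg = intertwiner_coeff_regular[OF assms(1-4)]
  show ?thesis
    using cong_add[OF cong_mult_left[OF reg(1) assms(5)] assms(6)]
      cong_add[OF cong_mult_left[OF reg(2) assms(5)] cong_mult_left[OF regular_to_fract assms(6), of qvar]]
    unfolding intertwiner_def by (cases "len (refl \<alpha> \<circ> u) < len u") (simp_all only: if_True if_False)
qed

lemma intertwiner_cong_shift:
  assumes \<beta>: "\<beta> \<in> \<Phi>" and \<gamma>: "\<gamma> \<in> \<Phi>" "\<gamma> \<noteq> \<beta>" "\<gamma> \<noteq> - \<beta>"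
    and \<gamma>': "\<gamma>' \<in> \<Phi>" "\<gamma>' \<noteq> \<beta>" "\<gamma>' \<noteq> - \<beta>" "\<gamma>' = \<gamma> + zscale m \<beta>"
    and f: "f u \<in> regular_along \<beta>"
  shows "cong_along \<beta> (intertwiner \<alpha> (Y \<gamma>') f u) (intertwiner \<alpha> (Y \<gamma>) f u)"
proof -
  have nz: "1 - Y \<gamma> \<noteq> 0" "1 - Y \<gamma>' \<noteq> 0" using Y_root_ne_1 \<gamma> \<gamma>' by auto
  obtain z where z: "z \<in> regular_along \<beta>" "Y \<gamma>' - Y \<gamma> = (1 - Y \<beta>) * z"
    using cong_ychar_shift[of \<beta> \<gamma> m] \<gamma>'(4) unfolding cong_along_def by blast
  define d where "d = (1 - Q) * z * (1 / (1 - Y \<gamma>')) * (1 / (1 - Y \<gamma>)) * f u"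
  have "d \<in> regular_along \<beta>"
    unfolding d_def using f z inverse_regular[OF \<beta> \<gamma>] inverse_regular[OF \<beta> \<gamma>'(1-3)]
    by (intro regular_mult regular_diff) auto
  moreover have "intertwiner \<alpha> (Y \<gamma>') f u - intertwiner \<alpha> (Y \<gamma>) f u =
      (1 - Q) * (Y \<gamma>' - Y \<gamma>) * (1 / (1 - Y \<gamma>')) * (1 / (1 - Y \<gamma>)) * f u"
  proof -
    have "1 / (1 - Y \<gamma>') - 1 / (1 - Y \<gamma>) = (Y \<gamma>' - Y \<gamma>) * (1 / (1 - Y \<gamma>')) * (1 / (1 - Y \<gamma>))"
      "Y \<gamma>' / (1 - Y \<gamma>') - Y \<gamma> / (1 - Y \<gamma>) = (Y \<gamma>' - Y \<gamma>) * (1 / (1 - Y \<gamma>')) * (1 / (1 - Y \<gamma>))"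
      using nz by (simp_all add: field_simps)
    note eqs = this
    have "intertwiner \<alpha> (Y \<gamma>') f u - intertwiner \<alpha> (Y \<gamma>) f u =
      (1 - Q) * (if len (refl \<alpha> \<circ> u) < len u then 1 / (1 - Y \<gamma>') - 1 / (1 - Y \<gamma>)
        else Y \<gamma>' / (1 - Y \<gamma>') - Y \<gamma> / (1 - Y \<gamma>)) * f u"
      by (cases "len (refl \<alpha> \<circ> u) < len u") (simp_all add: intertwiner_def right_diff_distrib left_diff_distrib)
    then show ?thesis unfolding eqs by (simp only: if_cancel mult.assoc)
  qed
  then have "intertwiner \<alpha> (Y \<gamma>') f u - intertwiner \<alpha> (Y \<gamma>) f u = (1 - Y \<beta>) * d"
    unfolding z(2) d_def by (simp only: ac_simps)
  ultimately show ?thesis unfolding cong_along_def by blast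
qed

lemma image_inv_simple:
  assumes "v \<in> W" "\<alpha> \<in> \<Delta>"
  shows "v (- inv v \<alpha>) = - \<alpha>"
  using weyl_bij[OF assms(1)] by (simp add: weyl_uminus[OF assms(1)] bij_is_surj surj_f_inv_f)

lemma weyl_eq_simple:
  assumes "v \<in> W" "v \<beta> = \<alpha>"
  shows "\<beta> = inv v \<alpha>"
  using assms(2) weyl_bij[OF assms(1)] by (metis bij_inv_eq_iff)

text \<open>
  Each step of the recursion down from \<open>w\<close> introduces a pole only along an inversion of \<open>w\<close>.
\<close>

lemma r_regular:
  "w \<in> W \<Longrightarrow> u \<in> W \<Longrightarrow> \<beta> \<in> Pos \<Longrightarrow> w \<beta> \<in> Pos \<Longrightarrow> r u w \<in> regular_along \<beta>"
proof (induction "len w" arbitrary: w u rule: less_induct)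
  case less
  note w = less.prems(1) and u = less.prems(2) and \<beta> = less.prems(3)
  show ?case
  proof (cases "w = id")
    case True
    then show ?thesis using r_id_regular[OF u] by simp
  next
    case False
    then obtain \<alpha> where \<alpha>: "\<alpha> \<in> \<Delta>" and \<gamma>: "- inv w \<alpha> \<in> Pos"
      using ex_left_descent[OF w] by blast
    let ?w = "refl \<alpha> \<circ> w"
    have ne: "- inv w \<alpha> \<noteq> \<beta>"
      using image_inv_simple[OF w \<alpha>] pos_not_neg[OF simple_pos[OF \<alpha>]] less.prems(4) by auto
    have ne': "- inv w \<alpha> \<noteq> - \<beta>"
      using pos_not_neg[OF \<beta>] \<gamma> by auto
    have "w \<beta> \<noteq> \<alpha>" using weyl_eq_simple[OF w] ne' by auto
    then have "?w \<beta> \<in> Pos" using simple_reflection_pos[OF \<alpha> less.prems(4)] by simp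
    then have "r u' ?w \<in> regular_along \<beta>" if "u' \<in> W" for u'
      using less.hyps[OF bruhat_less_len[OF left_descent[OF w \<alpha> \<gamma>]]] simple_comp_weyl[OF w \<alpha>] that \<beta>
      by blast
    from this[OF u] this[OF simple_comp_weyl[OF u \<alpha>]] show ?thesis
      unfolding r_recursion[OF u w \<alpha> \<gamma>]
      by (rule intertwiner_regular[OF pos_root[OF \<beta>] pos_root[OF \<gamma>] ne ne'])
  qed
qed

text \<open>
  The residue of \<open>r\<^sub>u\<^sub>,\<^sub>v\<close> along \<open>y\<^sup>\<beta> = 1\<close> is proportional to \<open>r\<^sub>u\<^sub>,\<^sub>w\<close> with \<open>w = v r\<^sub>\<beta>\<close>, by a factor
  \<open>\<kappa>\<close> that is the same for all \<open>u\<close>. The factor must not depend on \<open>u\<close>, because the recursion mixes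
  the values at \<open>u\<close> and \<open>r\<^sub>\<alpha> u\<close>.

  The induction descends from \<open>v\<close> to \<open>v' = r\<^sub>\<alpha> v\<close> by the intertwiner with parameter
  \<open>\<gamma> = - v\<^sup>-\<^sup>1 \<alpha>\<close>. If \<open>\<gamma> = \<beta>\<close>, the pole is created in this step and \<open>w = v'\<close>. Otherwise the residue
  of \<open>r\<^sub>u\<^sub>,\<^sub>v\<^sub>'\<close> is a multiple of \<open>r\<^sub>u\<^sub>,\<^sub>w\<^sub>'\<close> with \<open>w' = v' r\<^sub>\<beta> = r\<^sub>\<alpha> w\<close>, and the intertwiner has to be
  applied to it. Along \<open>y\<^sup>\<beta> = 1\<close> its parameter may be replaced by \<open>\<gamma>' = r\<^sub>\<beta> \<gamma> = - w\<^sup>-\<^sup>1 \<alpha>\<close>, which is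
  the one that belongs to \<open>w\<close>. If \<open>\<gamma>'\<close> is positive, this is the recursion from \<open>w'\<close> up to \<open>w\<close>. If it
  is negative, \<open>w'\<close> lies above \<open>w\<close>, and two opposite intertwiners compose to a scalar.
\<close>

lemma r_residue:
  "v \<in> W \<Longrightarrow> \<beta> \<in> Pos \<Longrightarrow> v \<beta> \<notin> Pos \<Longrightarrow>
    \<exists>\<kappa>\<in>regular_along \<beta>. \<forall>u\<in>W. cong_along \<beta> ((1 - Y \<beta>) * r u v) (\<kappa> * r u (v \<circ> refl \<beta>))"
proof (induction "len v" arbitrary: v rule: less_induct)
  case less
  note v = less.prems(1) and \<beta> = less.prems(2)
  note \<beta>_root = pos_root[OF \<beta>]
  have "v \<noteq> id" using less.prems by auto
  then obtain \<alpha> where \<alpha>: "\<alpha> \<in> \<Delta>" and \<gamma>: "- inv v \<alpha> \<in> Pos"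
    using ex_left_descent[OF v] by blast
  define \<gamma> where "\<gamma> = - inv v \<alpha>"
  have \<gamma>_pos: "\<gamma> \<in> Pos" using \<gamma> by (simp add: \<gamma>_def)
  note \<gamma>_root = pos_root[OF \<gamma>_pos]
  define v' where "v' = refl \<alpha> \<circ> v"
  have v': "v' \<in> W" unfolding v'_def using v \<alpha> by (rule simple_comp_weyl)
  have v'\<beta>: "v' \<beta> = refl \<alpha> (v \<beta>)" by (simp add: v'_def)
  have rec: "r u v = intertwiner \<alpha> (Y \<gamma>) (\<lambda>u. r u v') u" if "u \<in> W" for u
    unfolding \<gamma>_def v'_def using that v \<alpha> \<gamma> by (rule r_recursion)
  have ne': "\<gamma> \<noteq> - \<beta>" using pos_not_neg[OF \<beta>] \<gamma>_pos by auto
  show ?case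
  proof (cases "\<gamma> = \<beta>")
    case True
    have "refl \<beta> = refl (inv v \<alpha>)"
      using refl_uminus_root[OF inv_simple_root[OF v \<alpha>]] True by (simp add: \<gamma>_def)
    then have v_refl: "v \<circ> refl \<beta> = v'"
      using simple_comp[OF v \<alpha>] by (simp add: v'_def)
    have "v \<beta> = - \<alpha>" using image_inv_simple[OF v \<alpha>] True by (simp add: \<gamma>_def)
    then have "v' \<beta> = \<alpha>"
      using refl_self[OF simple_root[OF \<alpha>]] refl_involution[OF simple_root[OF \<alpha>], of \<alpha>] v'\<beta> by simp
    then have reg: "r u v' \<in> regular_along \<beta>" if "u \<in> W" for u
      using r_regular[OF v' that \<beta>] simple_pos[OF \<alpha>] by simp
    have "cong_along \<beta> ((1 - Y \<beta>) * r u v) ((1 - Q) * r u v')" if u: "u \<in> W" for u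
    proof -
      define a b where "a = r u v'" and "b = r (refl \<alpha> \<circ> u) v'"
      have ab: "a \<in> regular_along \<beta>" "b \<in> regular_along \<beta>"
        using reg u simple_comp_weyl[OF u \<alpha>] by (simp_all add: a_def b_def)
      have nz: "1 - Y \<beta> \<noteq> 0" using \<beta>_root by (rule Y_root_ne_1)
      \<comment> \<open>In the second case the recursion gives \<open>(1 - Q) * Y \<beta> * a\<close> in place of \<open>(1 - Q) * a\<close>; the term with \<open>a\<close>
        is their difference divided by \<open>1 - Y \<beta>\<close>.\<close>
      define z where "z = (if len (refl \<alpha> \<circ> u) < len u then b else Q * b - (1 - Q) * a)"
      have "z \<in> regular_along \<beta>"
        unfolding z_def using ab by (auto intro!: regular_intros)
      moreover have "(1 - Y \<beta>) * r u v - (1 - Q) * a = (1 - Y \<beta>) * z"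
      proof (cases "len (refl \<alpha> \<circ> u) < len u")
        case True
        then have "r u v = (1 - Q) / (1 - Y \<beta>) * a + b"
          using rec[OF u] \<open>\<gamma> = \<beta>\<close> by (simp add: intertwiner_def a_def b_def)
        then have "(1 - Y \<beta>) * r u v = (1 - Q) * a + (1 - Y \<beta>) * b"
          using nz by (simp only: distrib_left) simp
        then show ?thesis using True by (simp add: z_def)
      next
        case False
        then have "r u v = (1 - Q) * (Y \<beta> / (1 - Y \<beta>)) * a + Q * b"
          using rec[OF u] \<open>\<gamma> = \<beta>\<close> by (simp add: intertwiner_def a_def b_def)
        then have "(1 - Y \<beta>) * r u v = (1 - Q) * Y \<beta> * a + (1 - Y \<beta>) * (Q * b)"
          using nz by (simp only: distrib_left) simp
        then show ?thesis using False by (simp add: z_def algebra_simps)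
      qed
      ultimately show ?thesis unfolding cong_along_def a_def by blast
    qed
    then show ?thesis
      unfolding v_refl by (intro bexI[of _ "1 - Q"] ballI regular_diff) auto
  next
    case False
    have v'\<beta>_notpos: "v' \<beta> \<notin> Pos"
    proof
      assume pos: "v' \<beta> \<in> Pos"
      have v\<beta>: "v \<beta> = refl \<alpha> (v' \<beta>)"
        using v'\<beta> refl_involution[OF simple_root[OF \<alpha>]] by simp
      show False
      proof (cases "v' \<beta> = \<alpha>")
        case True
        then have "v (- \<beta>) = \<alpha>"
          using v\<beta> refl_self[OF simple_root[OF \<alpha>]] weyl_uminus[OF v] by simp
        then have "- \<beta> = inv v \<alpha>" by (rule weyl_eq_simple[OF v])
        then show False using False by (simp add: \<gamma>_def flip: \<open>- \<beta> = inv v \<alpha>\<close>)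
      next
        case False
        then show False using simple_reflection_pos[OF \<alpha> pos] v\<beta> less.prems(3) by simp
      qed
    qed
    have "len v' < len v"
      using bruhat_less_len[OF left_descent[OF v \<alpha> \<gamma>]] by (simp add: v'_def)
    then obtain \<kappa> where \<kappa>: "\<kappa> \<in> regular_along \<beta>"
      and IH: "\<And>u. u \<in> W \<Longrightarrow> cong_along \<beta> ((1 - Y \<beta>) * r u v') (\<kappa> * r u (v' \<circ> refl \<beta>))"
      using less.hyps[OF _ v' \<beta> v'\<beta>_notpos] by blast
    define w w' where "w = v \<circ> refl \<beta>" and "w' = v' \<circ> refl \<beta>"
    have w: "w \<in> W" "w' \<in> W"
      using v v' \<beta>_root by (auto simp: w_def w'_def intro!: weyl_comp weyl_reflection)
    have w'_eq: "w' = refl \<alpha> \<circ> w" by (simp add: w_def w'_def v'_def comp_assoc)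
    have image_refl: "(x \<circ> refl \<beta>) \<beta> \<in> Pos" if "x \<in> W" "x \<beta> \<notin> Pos" for x
      using that pos_or_neg[OF weyl_root[OF that(1) \<beta>_root]] refl_self[OF \<beta>_root] weyl_uminus[OF that(1)]
      by simp
    have reg: "r u w \<in> regular_along \<beta>" "r u w' \<in> regular_along \<beta>" if "u \<in> W" for u
      using r_regular[OF w(1) that \<beta>] r_regular[OF w(2) that \<beta>]
        image_refl[OF v less.prems(3)] image_refl[OF v' v'\<beta>_notpos] by (simp_all add: w_def w'_def)
    define \<gamma>' where "\<gamma>' = - inv w \<alpha>"
    have inv_w: "inv w = refl \<beta> \<circ> inv v"
    proof -
      have "inv (refl \<beta>) = refl \<beta>"
        using refl_comp_refl[OF \<beta>_root] refl_comp_refl[OF \<beta>_root] by (rule inv_unique_comp)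
      then show ?thesis
        unfolding w_def using o_inv_distrib[OF weyl_bij[OF v] bij_reflection[OF \<beta>_root]] by simp
    qed
    have \<gamma>'_refl: "\<gamma>' = refl \<beta> \<gamma>"
      unfolding \<gamma>'_def \<gamma>_def inv_w comp_apply weyl_uminus[OF weyl_reflection[OF \<beta>_root]] ..
    have \<gamma>'_root: "\<gamma>' \<in> \<Phi>" unfolding \<gamma>'_refl using \<beta>_root \<gamma>_root by (rule refl_root)
    have \<gamma>_refl: "\<gamma> = refl \<beta> \<gamma>'" by (simp add: \<gamma>'_refl refl_involution[OF \<beta>_root])
    have \<gamma>'_ne: "\<gamma>' \<noteq> \<beta>" "\<gamma>' \<noteq> - \<beta>"
      using \<gamma>_refl False ne' refl_self[OF \<beta>_root] refl_involution[OF \<beta>_root, of \<beta>] by auto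
    have \<gamma>_shift: "\<gamma> = \<gamma>' + zscale (coroot \<beta> \<gamma>) \<beta>"
      by (simp add: \<gamma>'_refl reflection_def)
    have step: "cong_along \<beta> ((1 - Y \<beta>) * r u v) (\<kappa> * intertwiner \<alpha> (Y \<gamma>') (\<lambda>u. r u w') u)"
      if u: "u \<in> W" for u
    proof -
      have "cong_along \<beta> (intertwiner \<alpha> (Y \<gamma>) (\<lambda>u. (1 - Y \<beta>) * r u v') u)
          (intertwiner \<alpha> (Y \<gamma>) (\<lambda>u. \<kappa> * r u w') u)"
        unfolding w'_def
        using \<beta>_root \<gamma>_root False ne' IH[OF u] IH[OF simple_comp_weyl[OF u \<alpha>]] by (rule intertwiner_cong)
      then have "cong_along \<beta> ((1 - Y \<beta>) * r u v) (\<kappa> * intertwiner \<alpha> (Y \<gamma>) (\<lambda>u. r u w') u)"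
        unfolding intertwiner_scale rec[OF u] .
      moreover have "cong_along \<beta> (\<kappa> * intertwiner \<alpha> (Y \<gamma>) (\<lambda>u. r u w') u)
          (\<kappa> * intertwiner \<alpha> (Y \<gamma>') (\<lambda>u. r u w') u)"
        using \<kappa> intertwiner_cong_shift[where f = "\<lambda>u. r u w'", OF \<beta>_root \<gamma>'_root \<gamma>'_ne \<gamma>_root False ne' \<gamma>_shift reg(2)[OF u]]
        by (rule cong_mult_left)
      ultimately show ?thesis by (rule cong_trans)
    qed
    show ?thesis
    proof (cases "\<gamma>' \<in> Pos")
      case True
      then have "r u w = intertwiner \<alpha> (Y \<gamma>') (\<lambda>u. r u w') u" if "u \<in> W" for u
        using r_recursion[OF that w(1) \<alpha>] by (simp add: \<gamma>'_def w'_eq)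
      then show ?thesis using step \<kappa> by (auto simp: w_def)
    next
      case False
      then have neg: "- \<gamma>' \<in> Pos" using pos_or_neg[OF \<gamma>'_root] by blast
      have inv_w': "inv w' \<alpha> = \<gamma>'"
        unfolding w'_eq \<gamma>'_def using w(1) \<alpha> by (rule inv_simple_comp)
      have "refl \<alpha> \<circ> w' = w" unfolding w'_eq using \<alpha> by (rule simple_comp_twice)
      then have rec': "r u w' = intertwiner \<alpha> (Y (- \<gamma>')) (\<lambda>u. r u w) u" if "u \<in> W" for u
        using r_recursion[OF that w(2) \<alpha>] neg by (simp add: inv_w')
      define c where "c = Q - (1 - Q) * (1 - Q) * Y \<gamma>' * (1 / (1 - Y \<gamma>')) * (1 / (1 - Y \<gamma>'))"
      have "intertwiner \<alpha> (Y \<gamma>') (\<lambda>u. r u w') u = c * r u w" if u: "u \<in> W" for u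
      proof -
        have "intertwiner \<alpha> (Y \<gamma>') (\<lambda>u. r u w') u = intertwiner \<alpha> (Y \<gamma>') (intertwiner \<alpha> (Y (- \<gamma>')) (\<lambda>u. r u w)) u"
          using rec'[OF u] rec'[OF simple_comp_weyl[OF u \<alpha>]] by (rule intertwiner_ext)
        then show ?thesis
          unfolding intertwiner_opposite[OF u \<alpha> Y_minus Y_root_ne_1[OF \<gamma>'_root]] c_def .
      qed
      then have "cong_along \<beta> ((1 - Y \<beta>) * r u v) (\<kappa> * c * r u w)" if "u \<in> W" for u
        using step[OF that] that by (simp add: mult.assoc)
      moreover have "\<kappa> * c \<in> regular_along \<beta>"
        unfolding c_def using \<kappa> inverse_regular[OF \<beta>_root \<gamma>'_root \<gamma>'_ne]
        by (intro regular_mult regular_diff) auto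
      ultimately show ?thesis by (auto simp: w_def)
    qed
  qed
qed

text \<open>
  If \<open>\<beta>\<close> is an inversion of \<open>v\<close> outside \<open>S(u, v)\<close>, then \<open>u \<le> v r\<^sub>\<beta>\<close> fails, so the residue
  vanishes by the support condition on \<open>r\<close>. If it lies in \<open>S(u, v)\<close>, its factor removes the pole,
  which is simple.
\<close>

lemma cleared_r_regular:
  assumes u: "u \<in> W" and v: "v \<in> W" and \<beta>: "\<beta> \<in> Pos"
  shows "(\<Prod>\<alpha>\<in>S_set \<Phi> coroot \<Delta> u v. 1 - Y \<alpha>) * r u v \<in> regular_along \<beta>"
proof -
  let ?S = "S_set \<Phi> coroot \<Delta> u v"
  have factors: "(\<Prod>\<alpha>\<in>A. 1 - Y \<alpha>) \<in> regular_along \<beta>" for A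
    by (intro regular_prod regular_diff) auto
  show ?thesis
  proof (cases "v \<beta> \<in> Pos")
    case True
    then show ?thesis using r_regular[OF v u \<beta>] factors by (intro regular_mult)
  next
    case False
    let ?w = "v \<circ> refl \<beta>"
    have w: "?w \<in> W" using v pos_root[OF \<beta>] by (intro weyl_comp weyl_reflection)
    have "?w \<beta> \<in> Pos"
      using False pos_or_neg[OF weyl_root[OF v pos_root[OF \<beta>]]] refl_self[OF pos_root[OF \<beta>]] weyl_uminus[OF v]
      by simp
    then have reg: "r u ?w \<in> regular_along \<beta>" using r_regular[OF w u \<beta>] by blast
    obtain \<kappa> z where \<kappa>: "\<kappa> \<in> regular_along \<beta>" and z: "z \<in> regular_along \<beta>"
      and residue: "(1 - Y \<beta>) * r u v - \<kappa> * r u ?w = (1 - Y \<beta>) * z"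
      using r_residue[OF v \<beta> False] u unfolding cong_along_def by blast
    show ?thesis
    proof (cases "bruhat_le \<Phi> coroot \<Delta> u ?w")
      case True
      then have "\<beta> \<in> ?S"
        using \<beta> bruhat_less_comp_reflection[OF v \<beta> False] by (simp add: S_set_def)
      moreover have "finite ?S"
        using finite_pos by (rule finite_subset[rotated]) (auto simp: S_set_def)
      ultimately have "(\<Prod>\<alpha>\<in>?S. 1 - Y \<alpha>) * r u v = (\<Prod>\<alpha>\<in>?S - {\<beta>}. 1 - Y \<alpha>) * ((1 - Y \<beta>) * r u v)"
        by (simp add: prod.remove mult.assoc mult.left_commute)
      moreover have "(1 - Y \<beta>) * r u v = \<kappa> * r u ?w + (1 - Y \<beta>) * z"
        using residue by (simp add: algebra_simps)
      moreover have "\<kappa> * r u ?w + (1 - Y \<beta>) * z \<in> regular_along \<beta>"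
        using \<kappa> z reg by (intro regular_add regular_mult regular_diff) auto
      ultimately show ?thesis using regular_mult[OF factors] by (simp only:)
    next
      case False
      then have "(1 - Y \<beta>) * r u v = (1 - Y \<beta>) * z"
        using residue r_support[OF u w] by simp
      then have "r u v = z"
        using Y_root_ne_1[OF pos_root[OF \<beta>]] by (simp only: mult_cancel_left) blast
      then show ?thesis using z factors by (intro regular_mult) auto
    qed
  qed
qed

end

theorem theorem7p3:
  fixes \<Phi> \<Delta> :: "'l::lattice_group set"
    and coroot :: "'l \<Rightarrow> 'l \<Rightarrow> int"
    and r :: "('l \<Rightarrow> 'l) \<Rightarrow> ('l \<Rightarrow> 'l) \<Rightarrow> 'l torus_ring fract"
    and u v :: "'l \<Rightarrow> 'l"
  assumes "based_root_datum \<Phi> coroot \<Delta>"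
    and "is_deformed_R \<Phi> coroot \<Delta> r"
    and "u \<in> weyl \<Phi> coroot" and "v \<in> weyl \<Phi> coroot"
  shows "(\<Prod>\<beta>\<in>S_set \<Phi> coroot \<Delta> u v. 1 - to_fract (ychar \<beta>)) * r u v
           \<in> range (to_fract :: 'l torus_ring \<Rightarrow> 'l torus_ring fract)"
proof -
  interpret deformed_R \<Phi> coroot \<Delta> r
    using assms(1,2) by (simp add: deformed_R_def deformed_R_axioms_def)
  let ?S = "S_set \<Phi> coroot \<Delta> u v"
  have "r u v \<in> localized_ring \<Phi> \<Delta>"
    using assms unfolding is_deformed_R_def by blast
  then obtain f k where "r u v = to_fract f / to_fract (\<Prod>\<alpha>\<in>Pos. (1 - ychar \<alpha>) ^ k \<alpha>)"
    unfolding localized_ring_def by blast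
  moreover have "(\<Prod>\<beta>\<in>A. 1 - Y \<beta>) = to_fract (\<Prod>\<beta>\<in>A. 1 - ychar \<beta>)" for A
    by (induction A rule: infinite_finite_induct) auto
  ultimately have "(\<Prod>\<beta>\<in>?S. 1 - Y \<beta>) * r u v =
      to_fract ((\<Prod>\<beta>\<in>?S. 1 - ychar \<beta>) * f) / to_fract (\<Prod>\<alpha>\<in>Pos. (1 - ychar \<alpha>) ^ k \<alpha>)"
    by simp
  moreover have "0 \<notin> Pos" using root_nonzero pos_root by blast
  ultimately show ?thesis
    using finite_pos cleared_r_regular[OF assms(3,4)] by (intro regular_everywhere)
qed

end
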